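(* Suppose that for every degree $d\in\mathbb{N}$ and every $i\in\{0,1,\dots,k+1\}$ the sum-of-squares program $\mathbf{M}_d(i)$ is solvable (has an optimal solution), let $p_i^{(d)}(\boldsymbol a)=\sum_\alpha\mathrm{p}^i_\alpha\boldsymbol a^\alpha$ be the polynomial given by an optimal solution, and let $R^{(d)}(i)=\{\boldsymbol a\in C_{\boldsymbol a}\mid p_i^{(d)}(\boldsymbol a)\le 0\}$. Suppose also that for every $i\in\{0,1,\dots,k+1\}$ the set $R_I^r(i)=\{\boldsymbol a\in C_{\boldsymbol a}\mid J_i(\boldsymbol a)=0\}$ has Lebesgue measure zero. Then $$\lim_{d\to\infty}\mu\bigl(R_I(i)\setminus R^{(d)}(i)\bigr)=0\qquad\text{for all } i\in\{0,1,\dots,k+1\}.$$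
   Context: Program data. $\boldsymbol x\in\mathbb{R}^n$ is the program state. The program is a loop with a precondition $\mathit{Pre}(\boldsymbol x)\le 0$, a postcondition $\mathit{Post}(\boldsymbol x)\le 0$, and $k$ branches: branch $i$ has guard $\boldsymbol c_i(\boldsymbol x)\le 0$ and assignment $\boldsymbol x:=\boldsymbol f_i(\boldsymbol x)$, $i=1,\dots,k$ (the guards are pairwise non-intersecting). Here $\mathit{Pre},\mathit{Post}$ are real polynomials and $\boldsymbol c_i,\boldsymbol f_i$ are (vector-valued) polynomial maps; inequalities between vectors are componentwise. States stay in a known compact set $C_{\boldsymbol x}=\{\boldsymbol x\in\mathbb{R}^n\mid h^{\boldsymbol x}_r(\boldsymbol x)\le 0,\ r=1,\dots,s_{\boldsymbol x}\}$, and a polynomial template $I(\boldsymbol a,\boldsymbol x)\in\mathbb{R}[\boldsymbol a,\boldsymbol x]$ is given with parameters $\boldsymbol a$ in a known compact set $C_{\boldsymbol a}=\{\boldsymbol a\in\mathbb{R}^m\mid h^{\boldsymbol a}_r(\boldsymbol a)\le 0,\ r=1,\dots,s_{\boldsymbol a}\}$ with $\mu(C_{\boldsymbol a})>0$; all $h^{\boldsymbol x}_r,h^{\boldsymbol a}_r$ are polynomials, and $\mu$ is Lebesgue measure. The sets $R_I(i)$. $R_I(0)=\{\boldsymbol a\in C_{\boldsymbol a}\mid\forall\boldsymbol x\in C_{\boldsymbol x}.\ \mathit{Pre}(\boldsymbol x)\le 0\Rightarrow I(\boldsymbol a,\boldsymbol x)\le 0\}$; $R_I(i)=\{\boldsymbol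 a\in C_{\boldsymbol a}\mid\forall\boldsymbol x\in C_{\boldsymbol x}.\ (\boldsymbol c_i(\boldsymbol x)\le 0\wedge I(\boldsymbol a,\boldsymbol x)\le 0)\Rightarrow I(\boldsymbol a,\boldsymbol f_i(\boldsymbol x))\le 0\}$ for $i=1,\dots,k$; $R_I(k+1)=\{\boldsymbol a\in C_{\boldsymbol a}\mid\forall\boldsymbol x\in C_{\boldsymbol x}.\ (\bigwedge_{i=1}^k\boldsymbol c_i(\boldsymbol x)\ge 0\wedge I(\boldsymbol a,\boldsymbol x)\le 0)\Rightarrow\mathit{Post}(\boldsymbol x)\le 0\}$. Each has the form $R_I(i)=\{\boldsymbol a\in C_{\boldsymbol a}\mid\forall\boldsymbol x\in\mathbf{K}_i(\boldsymbol a).\ l_i(\boldsymbol a,\boldsymbol x)\le 0\}$, where $\mathbf{K}_i(\boldsymbol a)=\{\boldsymbol x\in C_{\boldsymbol x}\mid g_{ir}(\boldsymbol a,\boldsymbol x)\le 0,\ r=1,\dots,m_i\}$, the polynomials $g_{ir}$ encode the premise of the $i$-th implication (with $\boldsymbol c_i\ge0$ written as $-\boldsymbol c_i\le0$), and $l_0=I(\boldsymbol a,\boldsymbol x)$, $l_i=I(\boldsymbol a,\boldsymbol f_i(\boldsymbol x))$ for $1\le i\le k$, $l_{k+1}=\mathit{Post}(\boldsymbol x)$. Fix a real $M>0$. For $\boldsymbol a\in C_{\boldsymbol a}$ let $\bar J_i(\boldsymbol a)=\sup_{\boldsymbol x\in\mathbf{K}_i(\boldsymbol a)}l_i(\boldsymbol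 a,\boldsymbol x)$ (equal to $-\infty$ if $\mathbf{K}_i(\boldsymbol a)=\emptyset$) and $J_i(\boldsymbol a)=\max(\bar J_i(\boldsymbol a),-M)$. SOS program. A quadratic module generated by $q_1,\dots,q_N$ is $\{\sigma_0+\sum_j\sigma_jq_j\}$ with $\sigma_j$ sums of squares; it is Archimedean if it contains $C-\|\cdot\|^2$ for some $C>0$. The quadratic modules corresponding to the inequality descriptions of $\mathbf{K}_i(\boldsymbol a)$, $C_{\boldsymbol a}$ and $C_{\boldsymbol x}$ (generated by the negatives of the polynomials required to be $\le 0$) are assumed Archimedean. For $d\in\mathbb{N}$, the program $\mathbf{M}_d(i)$ is: minimize $\sum_\alpha\gamma_\alpha\mathrm{p}^i_\alpha$ over real numbers $\mathrm{p}^i_\alpha$ ($|\alpha|\le 2d$) and sum-of-squares polynomials $\sigma_i,\sigma^K_{ir},\sigma^{\boldsymbol a}_{ir},\sigma^{\boldsymbol x}_{ir},\sigma'_i,\sigma'^K_{ir},\sigma'^{\boldsymbol a}_{ir},\sigma'^{\boldsymbol x}_{ir}$ in $(\boldsymbol a,\boldsymbol x)$ of degree at most $2d$, subject to the polynomial identities $p_i(\boldsymbol a)-l_i(\boldsymbol a,\boldsymbol x)=\sigma_i-\sum_{r=1}^{m_i}\sigma^K_{ir}g_{ir}-\sum_{r=1}^{s_{\boldsymbol a}}\sigma^{\boldsymbol a}_{ir}h^{\boldsymbol a}_r-\sum_{r=1}^{s_{\boldsymbol x}}\sigma^{\boldsymbol x}_{ir}h^{\boldsymbol x}_r$, $p_i(\boldsymbol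 a)+M=\sigma'_i-\sum_{r=1}^{m_i}\sigma'^K_{ir}g_{ir}-\sum_{r=1}^{s_{\boldsymbol a}}\sigma'^{\boldsymbol a}_{ir}h^{\boldsymbol a}_r-\sum_{r=1}^{s_{\boldsymbol x}}\sigma'^{\boldsymbol x}_{ir}h^{\boldsymbol x}_r$, where $p_i(\boldsymbol a)=\sum_{|\alpha|\le 2d}\mathrm{p}^i_\alpha\boldsymbol a^\alpha$ and $\gamma_\alpha=\frac{1}{\mu(C_{\boldsymbol a})}\int_{C_{\boldsymbol a}}\boldsymbol a^\alpha\,d\mu(\boldsymbol a)$. *)

theory Defs
  imports "HOL-Analysis.Analysis" "HOL-Library.Poly_Mapping"
begin

section \<open>Real polynomials in finitely many variables\<close>

text \<open>
  A polynomial is a finitely supported map from exponent vectors to coefficients; the ring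
  operations are the convolution operations of \<^theory>\<open>HOL-Library.Poly_Mapping\<close>. Polynomials in
  the parameters and the state, i.e. in \<open>\<real>[a, x]\<close>, use the index type \<^typ>\<open>'m + 'n\<close>:
  \<^const>\<open>Inl\<close> for the parameters, \<^const>\<open>Inr\<close> for the state variables.
\<close>

type_synonym 'v mpoly = "('v \<Rightarrow>\<^sub>0 nat) \<Rightarrow>\<^sub>0 real"

definition mconst :: "real \<Rightarrow> 'v mpoly" where
  "mconst c = Poly_Mapping.single 0 c"

definition mvar :: "'v \<Rightarrow> 'v mpoly" where
  "mvar v = Poly_Mapping.single (Poly_Mapping.single v 1) 1"

definition mon_deg :: "('v::finite \<Rightarrow>\<^sub>0 nat) \<Rightarrow> nat" where
  "mon_deg \<alpha> = (\<Sum>v\<in>UNIV. Poly_Mapping.lookup \<alpha> v)"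

definition deg_le :: "nat \<Rightarrow> ('v::finite) mpoly \<Rightarrow> bool" where
  "deg_le D p \<longleftrightarrow> (\<forall>\<alpha>\<in>Poly_Mapping.keys p. mon_deg \<alpha> \<le> D)"

text \<open>
  The ring homomorphism out of the polynomial ring determined by the images \<open>\<phi>\<close> of the
  constants and \<open>h\<close> of the variables.
\<close>

definition mhom :: "(real \<Rightarrow> 'r::comm_ring_1) \<Rightarrow> ('v::finite \<Rightarrow> 'r) \<Rightarrow> 'v mpoly \<Rightarrow> 'r" where
  "mhom \<phi> h p = (\<Sum>\<alpha>\<in>Poly_Mapping.keys p.
     \<phi> (Poly_Mapping.lookup p \<alpha>) * (\<Prod>v\<in>UNIV. h v ^ Poly_Mapping.lookup \<alpha> v))"

definition meval :: "real ^ 'v \<Rightarrow> ('v::finite) mpoly \<Rightarrow> real" where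
  "meval x p = mhom (\<lambda>c. c) (\<lambda>v. x $ v) p"

definition meval2 :: "real ^ 'm \<Rightarrow> real ^ 'n \<Rightarrow> ('m::finite + 'n::finite) mpoly \<Rightarrow> real" where
  "meval2 a x p = mhom (\<lambda>c. c) (case_sum (\<lambda>u. a $ u) (\<lambda>v. x $ v)) p"

definition msubst :: "('v::finite \<Rightarrow> 'w mpoly) \<Rightarrow> 'v mpoly \<Rightarrow> 'w mpoly" where
  "msubst h p = mhom mconst h p"

definition emb_a :: "('m::finite) mpoly \<Rightarrow> ('m + 'n::finite) mpoly" where
  "emb_a p = msubst (\<lambda>u. mvar (Inl u)) p"

definition emb_x :: "('n::finite) mpoly \<Rightarrow> ('m::finite + 'n) mpoly" where
  "emb_x p = msubst (\<lambda>v. mvar (Inr v)) p"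

text \<open>The polynomial \<open>p(a, \<cdot>) \<in> \<real>[x]\<close> obtained by fixing the parameters.\<close>

definition specialize :: "real ^ 'm \<Rightarrow> ('m::finite + 'n::finite) mpoly \<Rightarrow> 'n mpoly" where
  "specialize a p = msubst (case_sum (\<lambda>u. mconst (a $ u)) mvar) p"

definition sos :: "('v::finite) mpoly \<Rightarrow> bool" where
  "sos p \<longleftrightarrow> (\<exists>qs. p = (\<Sum>q\<leftarrow>qs. q ^ 2))"

definition quadratic_module :: "('v::finite) mpoly list \<Rightarrow> 'v mpoly set" where
  "quadratic_module qs = {\<sigma>0 + (\<Sum>j<length qs. \<sigma> j * qs ! j) | \<sigma>0 \<sigma>.
     sos \<sigma>0 \<and> (\<forall>j<length qs. sos (\<sigma> j))}"

definition archimedean_module :: "('v::finite) mpoly set \<Rightarrow> bool" where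
  "archimedean_module Q \<longleftrightarrow> (\<exists>C>0. mconst C - (\<Sum>v\<in>UNIV. mvar v ^ 2) \<in> Q)"

section \<open>Programs and invariant templates\<close>

text \<open>
  A list of polynomials stands for a vector-valued polynomial map. Only the guards and
  assignments with index in \<open>{1..num_branches}\<close> are meaningful; \<open>C_x\<close> and \<open>C_a\<close> are described
  by \<open>hx\<close> and \<open>ha\<close>.
\<close>

record ('m, 'n) problem =
  Pre :: "'n mpoly"
  Post :: "'n mpoly"
  num_branches :: nat
  guard :: "nat \<Rightarrow> 'n mpoly list"
  assignment :: "nat \<Rightarrow> 'n \<Rightarrow> 'n mpoly"
  hx :: "'n mpoly list"
  ha :: "'m mpoly list"
  template :: "('m + 'n) mpoly"

definition guard_le :: "('m::finite, 'n::finite) problem \<Rightarrow> nat \<Rightarrow> real ^ 'n \<Rightarrow> bool" where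
  "guard_le P i x \<longleftrightarrow> (\<forall>c\<in>set (guard P i). meval x c \<le> 0)"

definition guard_ge :: "('m::finite, 'n::finite) problem \<Rightarrow> nat \<Rightarrow> real ^ 'n \<Rightarrow> bool" where
  "guard_ge P i x \<longleftrightarrow> (\<forall>c\<in>set (guard P i). meval x c \<ge> 0)"

definition assign :: "('m::finite, 'n::finite) problem \<Rightarrow> nat \<Rightarrow> real ^ 'n \<Rightarrow> real ^ 'n" where
  "assign P i x = (\<chi> v. meval x (assignment P i v))"

definition guards_disjoint :: "('m::finite, 'n::finite) problem \<Rightarrow> bool" where
  "guards_disjoint P \<longleftrightarrow> (\<forall>i\<in>{1..num_branches P}. \<forall>j\<in>{1..num_branches P}.
     i \<noteq> j \<longrightarrow> \<not> (\<exists>x. guard_le P i x \<and> guard_le P j x))"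

definition C_x :: "('m::finite, 'n::finite) problem \<Rightarrow> (real ^ 'n) set" where
  "C_x P = {x. \<forall>h\<in>set (hx P). meval x h \<le> 0}"

definition C_a :: "('m::finite, 'n::finite) problem \<Rightarrow> (real ^ 'm) set" where
  "C_a P = {a. \<forall>h\<in>set (ha P). meval a h \<le> 0}"

inductive reachable :: "('m::finite, 'n::finite) problem \<Rightarrow> real ^ 'n \<Rightarrow> bool"
  for P where
  init: "x \<in> C_x P \<Longrightarrow> meval x (Pre P) \<le> 0 \<Longrightarrow> reachable P x"
| step: "reachable P x \<Longrightarrow> i \<in> {1..num_branches P} \<Longrightarrow> guard_le P i x \<Longrightarrow> reachable P (assign P i x)"

definition states_stay :: "('m::finite, 'n::finite) problem \<Rightarrow> bool" where
  "states_stay P \<longleftrightarrow> (\<forall>x. reachable P x \<longrightarrow> x \<in> C_x P)"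

definition R_I :: "('m::finite, 'n::finite) problem \<Rightarrow> nat \<Rightarrow> (real ^ 'm) set" where
  "R_I P i =
    (if i = 0 then
       {a \<in> C_a P. \<forall>x\<in>C_x P. meval x (Pre P) \<le> 0 \<longrightarrow> meval2 a x (template P) \<le> 0}
     else if i \<le> num_branches P then
       {a \<in> C_a P. \<forall>x\<in>C_x P. guard_le P i x \<and> meval2 a x (template P) \<le> 0
          \<longrightarrow> meval2 a (assign P i x) (template P) \<le> 0}
     else
       {a \<in> C_a P. \<forall>x\<in>C_x P. (\<forall>j\<in>{1..num_branches P}. guard_ge P j x)
          \<and> meval2 a x (template P) \<le> 0 \<longrightarrow> meval x (Post P) \<le> 0})"

text \<open>
  The polynomials \<open>g\<^sub>i\<^sub>r\<close> and \<open>l\<^sub>i\<close> that encode the premise and the conclusion of the \<open>i\<close>-th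
  implication; every index above \<open>num_branches\<close> denotes the exit condition.
\<close>

definition premise :: "('m::finite, 'n::finite) problem \<Rightarrow> nat \<Rightarrow> ('m + 'n) mpoly list" where
  "premise P i =
    (if i = 0 then [emb_x (Pre P)]
     else if i \<le> num_branches P then map emb_x (guard P i) @ [template P]
     else concat (map (\<lambda>j. map (\<lambda>c. - emb_x c) (guard P j)) [1..<Suc (num_branches P)])
       @ [template P])"

definition concl :: "('m::finite, 'n::finite) problem \<Rightarrow> nat \<Rightarrow> ('m + 'n) mpoly" where
  "concl P i =
    (if i = 0 then template P
     else if i \<le> num_branches P then
       msubst (case_sum (\<lambda>u. mvar (Inl u)) (\<lambda>v. emb_x (assignment P i v))) (template P)
     else emb_x (Post P))"

definition K :: "('m::finite, 'n::finite) problem \<Rightarrow> nat \<Rightarrow> real ^ 'm \<Rightarrow> (real ^ 'n) set" where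
  "K P i a = {x \<in> C_x P. \<forall>g\<in>set (premise P i). meval2 a x g \<le> 0}"

text \<open>Suprema are taken in \<^typ>\<open>ereal\<close>, where the empty supremum is \<open>-\<infinity>\<close>.\<close>

definition J_bar :: "('m::finite, 'n::finite) problem \<Rightarrow> nat \<Rightarrow> real ^ 'm \<Rightarrow> ereal" where
  "J_bar P i a = (SUP x\<in>K P i a. ereal (meval2 a x (concl P i)))"

definition J :: "('m::finite, 'n::finite) problem \<Rightarrow> real \<Rightarrow> nat \<Rightarrow> real ^ 'm \<Rightarrow> ereal" where
  "J P M i a = max (J_bar P i a) (ereal (- M))"

definition R_I_r :: "('m::finite, 'n::finite) problem \<Rightarrow> real \<Rightarrow> nat \<Rightarrow> (real ^ 'm) set" where
  "R_I_r P M i = {a \<in> C_a P. J P M i a = 0}"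

section \<open>The sum-of-squares program\<close>

text \<open>
  A feasible or optimal point consists of the polynomial \<open>p\<close> (i.e. its coefficients) and the
  multipliers of the two identities. The multiplier families are indexed from 0, and only
  the entries with index below the number of constraint polynomials matter.
\<close>

record ('m, 'n) multipliers =
  mult0 :: "('m + 'n) mpoly"
  multK :: "nat \<Rightarrow> ('m + 'n) mpoly"
  multa :: "nat \<Rightarrow> ('m + 'n) mpoly"
  multx :: "nat \<Rightarrow> ('m + 'n) mpoly"

record ('m, 'n) sos_point =
  bound_poly :: "'m mpoly"
  mults :: "('m, 'n) multipliers"
  mults' :: "('m, 'n) multipliers"

definition valid_multipliers ::
  "('m::finite, 'n::finite) problem \<Rightarrow> nat \<Rightarrow> nat \<Rightarrow> ('m, 'n) multipliers \<Rightarrow> bool" where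
  "valid_multipliers P d i s \<longleftrightarrow>
     (let ok = (\<lambda>q. sos q \<and> deg_le (2 * d) q) in
       ok (mult0 s)
       \<and> (\<forall>r<length (premise P i). ok (multK s r))
       \<and> (\<forall>r<length (ha P). ok (multa s r))
       \<and> (\<forall>r<length (hx P). ok (multx s r)))"

definition representation ::
  "('m::finite, 'n::finite) problem \<Rightarrow> nat \<Rightarrow> ('m, 'n) multipliers \<Rightarrow> ('m + 'n) mpoly" where
  "representation P i s = mult0 s
     - (\<Sum>r<length (premise P i). multK s r * premise P i ! r)
     - (\<Sum>r<length (ha P). multa s r * emb_a (ha P ! r))
     - (\<Sum>r<length (hx P). multx s r * emb_x (hx P ! r))"

definition feasible ::
  "('m::finite, 'n::finite) problem \<Rightarrow> real \<Rightarrow> nat \<Rightarrow> nat \<Rightarrow> ('m, 'n) sos_point \<Rightarrow> bool" where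
  "feasible P M d i s \<longleftrightarrow>
     deg_le (2 * d) (bound_poly s)
     \<and> valid_multipliers P d i (mults s) \<and> valid_multipliers P d i (mults' s)
     \<and> emb_a (bound_poly s) - concl P i = representation P i (mults s)
     \<and> emb_a (bound_poly s) + mconst M = representation P i (mults' s)"

definition moment :: "('m::finite, 'n::finite) problem \<Rightarrow> ('m \<Rightarrow>\<^sub>0 nat) \<Rightarrow> real" where
  "moment P \<alpha> = 1 / measure lebesgue (C_a P) *
     (LINT a:C_a P|lebesgue. (\<Prod>u\<in>UNIV. a $ u ^ Poly_Mapping.lookup \<alpha> u))"

definition objective :: "('m::finite, 'n::finite) problem \<Rightarrow> ('m, 'n) sos_point \<Rightarrow> real" where
  "objective P s = (\<Sum>\<alpha>\<in>Poly_Mapping.keys (bound_poly s).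
     moment P \<alpha> * Poly_Mapping.lookup (bound_poly s) \<alpha>)"

definition optimal_solution ::
  "('m::finite, 'n::finite) problem \<Rightarrow> real \<Rightarrow> nat \<Rightarrow> nat \<Rightarrow> ('m, 'n) sos_point \<Rightarrow> bool" where
  "optimal_solution P M d i s \<longleftrightarrow>
     feasible P M d i s \<and> (\<forall>s'. feasible P M d i s' \<longrightarrow> objective P s \<le> objective P s')"

definition R_approx ::
  "('m::finite, 'n::finite) problem \<Rightarrow> ('m, 'n) sos_point \<Rightarrow> (real ^ 'm) set" where
  "R_approx P s = {a \<in> C_a P. meval a (bound_poly s) \<le> 0}"

end

theory Submission
  imports Defs
begin

text \<open>
  Write \<open>p\<^sub>d\<close> for the optimal polynomials. Feasibility gives \<open>p\<^sub>d \<ge> J\<close> wherever the fibre \<open>K a\<close> is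
  nonempty, and solvability forces the empty fibres to form a null set. Conversely \<open>J\<close> is upper
  semicontinuous, so there are polynomials lying strictly above the data whose means over \<open>C_a\<close>
  approach the mean of \<open>J\<close>; Putinar's Positivstellensatz makes each of them feasible for large \<open>d\<close>.
  Hence \<open>p\<^sub>d \<rightarrow> J\<close> in mean, and as \<open>{J = 0}\<close> is null, Markov's inequality bounds the measure of
  \<open>{J \<le> 0 < p\<^sub>d}\<close>.

  The Positivstellensatz is proved without duality: a polynomial \<open>f > 0\<close> on \<open>{g\<^sub>j \<ge> 0}\<close> is turned into
  \<open>f - \<Sum>q\<^sub>j\<^sup>2 g\<^sub>j > 0\<close> on a large box by approximating the square root of \<open>c max(0, -g\<^sub>j)\<close>, and a polynomial
  that is positive on a box has, in a high enough degree, positive Bernstein coefficients.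
\<close>

section \<open>Polynomials as a free algebra\<close>

text \<open>Both identities of the program, including the one for the bound by \<open>-M\<close>,
  carry multipliers of the premise, so they certify inequalities only at pairs \<open>(a, x)\<close>
  with \<open>x\<close> in the fibre above \<open>a\<close>. Even the bound by \<open>-M\<close> is
  lost above an empty fibre, which is why the estimate from below can hold only almost everywhere.
  No degree bound for certificates enters: each \<epsilon> gets one fixed majorant, its certificate
  has some finite degree, and from that degree on it competes with the optimal solutions. The
  majorants have to be strict because the Positivstellensatz speaks about strict positivity. The
  algebraic obstacle is that a quadratic module is in general not closed under products, whereas a
  Bernstein expansion consists of products. Hence the constraints are first absorbed by square
  multipliers, and the expansion then takes place in the module of the single polynomial
  \<open>C - |x|^2\<close>, which is a semiring.\<close>

locale ring_morphism =
  fixes F :: "'a::comm_ring_1 \<Rightarrow> 'b::comm_ring_1"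
  assumes one: "F 1 = 1"
    and add: "F (x + y) = F x + F y"
    and mult: "F (x * y) = F x * F y"
begin

lemma zero: "F 0 = 0"
  using add[of 0 0] by simp

lemma uminus: "F (- x) = - F x"
  using add[of x "- x"] zero by (simp add: eq_neg_iff_add_eq_0 add.commute)

lemma diff: "F (x - y) = F x - F y"
  using add[of x "- y"] by (simp add: uminus)

lemma power: "F (x ^ n) = F x ^ n"
  by (induction n) (simp_all add: one mult)

lemma sum: "F (sum f A) = (\<Sum>x\<in>A. F (f x))"
  by (induction A rule: infinite_finite_induct) (simp_all add: zero add)

lemma prod: "F (prod f A) = (\<Prod>x\<in>A. F (f x))"
  by (induction A rule: infinite_finite_induct) (simp_all add: one mult)

lemma sum_list: "F (\<Sum>x\<leftarrow>xs. f x) = (\<Sum>x\<leftarrow>xs. F (f x))"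
  by (induction xs) (simp_all add: zero add)

end

lemma ring_morphism_id: "ring_morphism (\<lambda>x. x)"
  by unfold_locales auto

lemma ring_morphism_mconst: "ring_morphism mconst"
  by unfold_locales (simp_all add: mconst_def single_add mult_single)

interpretation mconst: ring_morphism mconst
  by (rule ring_morphism_mconst)

section \<open>The homomorphism determined by the images of constants and variables\<close>

lemma sum_monomials:
  "(\<Sum>\<alpha>\<in>Poly_Mapping.keys p. Poly_Mapping.single \<alpha> (Poly_Mapping.lookup p \<alpha>)) = p"
  by (rule poly_mapping_eqI)
    (auto simp: lookup_sum lookup_single when_def not_in_keys_iff_lookup_eq_zero)

text \<open>Coefficients off the support are mapped to zero. This lets polynomials with different
  supports share one index set.\<close>

lemma mhom_superset:
  assumes "ring_morphism \<phi>" "finite A" "Poly_Mapping.keys p \<subseteq> A"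
  shows "mhom \<phi> h p = (\<Sum>\<alpha>\<in>A. \<phi> (Poly_Mapping.lookup p \<alpha>) * (\<Prod>v\<in>UNIV. h v ^ Poly_Mapping.lookup \<alpha> v))"
  unfolding mhom_def
  by (rule sum.mono_neutral_left)
    (use assms in \<open>auto simp: not_in_keys_iff_lookup_eq_zero ring_morphism.zero\<close>)

lemma mhom_add:
  assumes "ring_morphism \<phi>"
  shows "mhom \<phi> h (p + q) = mhom \<phi> h p + mhom \<phi> h q"
proof -
  let ?A = "Poly_Mapping.keys p \<union> Poly_Mapping.keys q"
  have "Poly_Mapping.keys (p + q) \<subseteq> ?A" by (rule keys_add)
  then show ?thesis
    by (simp add: mhom_superset[OF assms, of ?A] lookup_add ring_morphism.add[OF assms]
        distrib_right sum.distrib)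
qed

lemma mhom_single:
  assumes "ring_morphism \<phi>"
  shows "mhom \<phi> h (Poly_Mapping.single \<alpha> c) = \<phi> c * (\<Prod>v\<in>UNIV. h v ^ Poly_Mapping.lookup \<alpha> v)"
  using mhom_superset[OF assms, of "{\<alpha>}" "Poly_Mapping.single \<alpha> c" h] by simp

lemma mhom_zero: "mhom \<phi> h 0 = 0"
  by (simp add: mhom_def)

lemma mhom_sum:
  assumes "ring_morphism \<phi>"
  shows "mhom \<phi> h (sum f A) = (\<Sum>x\<in>A. mhom \<phi> h (f x))"
  by (induction A rule: infinite_finite_induct) (simp_all add: mhom_zero mhom_add[OF assms])

lemma mhom_mult:
  assumes "ring_morphism \<phi>"
  shows "mhom \<phi> h (p * q) = mhom \<phi> h p * mhom \<phi> h q"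
proof -
  let ?s = "\<lambda>p \<alpha>. Poly_Mapping.single \<alpha> (Poly_Mapping.lookup p \<alpha>)"
  have "p * q = (\<Sum>\<alpha>\<in>Poly_Mapping.keys p. ?s p \<alpha>) * (\<Sum>\<beta>\<in>Poly_Mapping.keys q. ?s q \<beta>)"
    by (simp add: sum_monomials)
  also have "\<dots> = (\<Sum>\<alpha>\<in>Poly_Mapping.keys p. \<Sum>\<beta>\<in>Poly_Mapping.keys q. ?s p \<alpha> * ?s q \<beta>)"
    by (rule sum_product)
  also have "mhom \<phi> h \<dots> =
      (\<Sum>\<alpha>\<in>Poly_Mapping.keys p. \<Sum>\<beta>\<in>Poly_Mapping.keys q. mhom \<phi> h (?s p \<alpha>) * mhom \<phi> h (?s q \<beta>))"
    by (simp add: mhom_sum[OF assms] mhom_single[OF assms] mult_single lookup_add power_add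
        prod.distrib ring_morphism.mult[OF assms] mult_ac)
  also have "\<dots> = mhom \<phi> h (\<Sum>\<alpha>\<in>Poly_Mapping.keys p. ?s p \<alpha>) * mhom \<phi> h (\<Sum>\<beta>\<in>Poly_Mapping.keys q. ?s q \<beta>)"
    by (simp add: mhom_sum[OF assms] sum_product)
  finally show ?thesis by (simp add: sum_monomials)
qed

lemma mhom_mconst:
  assumes "ring_morphism \<phi>"
  shows "mhom \<phi> h (mconst c) = \<phi> c"
  by (simp add: mconst_def mhom_single[OF assms])

lemma prod_power_single:
  fixes h :: "'v::finite \<Rightarrow> 'r::comm_ring_1"
  shows "(\<Prod>w\<in>UNIV. h w ^ Poly_Mapping.lookup (Poly_Mapping.single v 1) w) = h v"
proof -
  have "(\<Prod>w\<in>UNIV. h w ^ Poly_Mapping.lookup (Poly_Mapping.single v 1) w)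
      = (\<Prod>w\<in>UNIV. if w = v then h w else 1)"
    by (rule prod.cong) (auto simp: lookup_single when_def)
  then show ?thesis by simp
qed

lemma mhom_mvar:
  assumes "ring_morphism \<phi>"
  shows "mhom \<phi> h (mvar v) = h v"
  unfolding mvar_def mhom_single[OF assms] prod_power_single
  by (simp add: ring_morphism.one[OF assms])

lemma ring_morphism_mhom:
  assumes "ring_morphism \<phi>"
  shows "ring_morphism (mhom \<phi> h)"
proof
  have "mhom \<phi> h (mconst 1) = 1"
    using assms by (simp add: mhom_mconst ring_morphism.one)
  then show "mhom \<phi> h 1 = 1" by (simp add: mconst.one)
qed (simp_all add: mhom_add[OF assms] mhom_mult[OF assms])

text \<open>A morphism commutes with the finite sums, products and powers that make up
  \<open>mhom\<close>. The composition laws \<open>meval_msubst\<close> and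
  \<open>msubst_msubst\<close> are both instances.\<close>

lemma morphism_mhom:
  assumes "ring_morphism F"
  shows "F (mhom \<phi> h p) = mhom (\<lambda>c. F (\<phi> c)) (\<lambda>v. F (h v)) p"
proof -
  interpret ring_morphism F by fact
  show ?thesis unfolding mhom_def by (simp add: sum mult prod power)
qed

lemma prod_mvar_power:
  fixes \<alpha> :: "'v::finite \<Rightarrow>\<^sub>0 nat"
  shows "(\<Prod>v\<in>UNIV. mvar v ^ Poly_Mapping.lookup \<alpha> v) = Poly_Mapping.single \<alpha> 1"
proof -
  have pow: "mvar v ^ k = Poly_Mapping.single (Poly_Mapping.single v k) 1" for v :: 'v and k
    by (induction k) (simp_all add: mvar_def mult_single single_add[symmetric])
  have "(\<Prod>v\<in>A. Poly_Mapping.single (f v) (1::real)) = Poly_Mapping.single (sum f A) 1"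
    for A :: "'v set" and f :: "'v \<Rightarrow> 'v \<Rightarrow>\<^sub>0 nat"
    by (induction A rule: infinite_finite_induct) (simp_all add: mult_single)
  moreover have "(\<Sum>v\<in>UNIV. Poly_Mapping.single v (Poly_Mapping.lookup \<alpha> v)) = \<alpha>"
    by (rule poly_mapping_eqI) (simp add: lookup_sum lookup_single when_def)
  ultimately show ?thesis by (simp add: pow)
qed

lemma mhom_mconst_mvar: "mhom mconst mvar p = p"
  unfolding mhom_def prod_mvar_power
  by (simp add: mconst_def mult_single sum_monomials)

section \<open>Evaluation, substitution and joint points of parameters and states\<close>

lemma ring_morphism_meval: "ring_morphism (meval x)"
  unfolding meval_def[abs_def] by (rule ring_morphism_mhom[OF ring_morphism_id])

interpretation meval: ring_morphism "meval x"
  by (rule ring_morphism_meval)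

lemma meval_mconst [simp]: "meval x (mconst c) = c"
  by (simp add: meval_def mhom_mconst ring_morphism_id)

lemma meval_mvar [simp]: "meval x (mvar v) = x $ v"
  by (simp add: meval_def mhom_mvar ring_morphism_id)

lemma ring_morphism_msubst: "ring_morphism (msubst h)"
  unfolding msubst_def[abs_def] by (rule ring_morphism_mhom[OF ring_morphism_mconst])

interpretation msubst: ring_morphism "msubst h"
  by (rule ring_morphism_msubst)

lemma msubst_mconst [simp]: "msubst h (mconst c) = mconst c"
  by (simp add: msubst_def mhom_mconst ring_morphism_mconst)

lemma msubst_mvar [simp]: "msubst h (mvar v) = h v"
  by (simp add: msubst_def mhom_mvar ring_morphism_mconst)

lemma meval_msubst: "meval x (msubst h p) = meval (\<chi> v. meval x (h v)) p"
proof -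
  have "meval x (mhom mconst h p) = mhom (\<lambda>c. c) (\<lambda>v. meval x (h v)) p"
    unfolding morphism_mhom[OF ring_morphism_meval] by simp
  then show ?thesis by (simp add: msubst_def meval_def)
qed

lemma msubst_msubst: "msubst h (msubst k p) = msubst (\<lambda>v. msubst h (k v)) p"
proof -
  have "msubst h (mhom mconst k p) = mhom mconst (\<lambda>v. msubst h (k v)) p"
    unfolding morphism_mhom[OF ring_morphism_msubst] by simp
  then show ?thesis by (simp add: msubst_def)
qed

lemma msubst_id: "msubst mvar p = p"
  by (simp add: msubst_def mhom_mconst_mvar)

definition join_vec :: "real ^ 'm \<Rightarrow> real ^ 'n \<Rightarrow> real ^ ('m::finite + 'n::finite)" where
  "join_vec a x = (\<chi> v. case_sum (\<lambda>u. a $ u) (\<lambda>w. x $ w) v)"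

lemma meval2_eq: "meval2 a x p = meval (join_vec a x) p"
  by (simp add: meval2_def meval_def join_vec_def)

lemma meval2_emb_a [simp]: "meval2 a x (emb_a p) = meval a p"
  by (simp add: meval2_eq emb_a_def meval_msubst join_vec_def)

lemma meval2_emb_x [simp]: "meval2 a x (emb_x p) = meval x p"
  by (simp add: meval2_eq emb_x_def meval_msubst join_vec_def)

text \<open>Connects the algebraic substitution in \<open>concl\<close> with the semantic
  \<open>assign\<close> in \<open>R_I\<close>.\<close>

lemma meval2_subst_x:
  "meval2 a x (msubst (case_sum (\<lambda>u. mvar (Inl u)) (\<lambda>v. emb_x (f v))) p)
    = meval2 a (\<chi> v. meval x (f v)) p"
proof -
  have "(\<chi> v. meval (join_vec a x) (case_sum (\<lambda>u. mvar (Inl u)) (\<lambda>v. emb_x (f v)) v))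
      = join_vec a (\<chi> v. meval x (f v))"
    by (auto simp: vec_eq_iff join_vec_def split: sum.split)
      (metis join_vec_def meval2_emb_x meval2_eq)
  then show ?thesis by (simp add: meval2_eq meval_msubst)
qed

section \<open>Continuity and density of polynomials on compact sets\<close>

lemma continuous_on_meval: "continuous_on A (\<lambda>x. meval x p)"
  unfolding meval_def mhom_def by (intro continuous_intros)

lemma continuous_on_meval2:
  "continuous_on A (\<lambda>z. meval2 (fst z) (snd z) p)"
proof -
  have 1: "continuous_on A (\<lambda>z. case_sum (\<lambda>u. fst z $ u) (\<lambda>v. snd z $ v) w)" for w
    by (cases w) (auto intro!: continuous_intros)
  show ?thesis unfolding meval2_def mhom_def by (intro continuous_intros 1)
qed

text \<open>Stone-Weierstrass delivers polynomial functions, while certificates need formal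
  polynomials. Linear functions are expanded in the standard basis; the other cases follow since
  evaluation is a morphism.\<close>

lemma real_polynomial_function_meval:
  fixes g :: "real ^ 'v::finite \<Rightarrow> real"
  assumes "real_polynomial_function g"
  obtains p where "\<And>x. g x = meval x p"
proof -
  from assms have "\<exists>p. \<forall>x. g x = meval x p"
  proof induction
    case (linear f)
    then interpret f: bounded_linear f .
    have *: "f x = (\<Sum>v\<in>UNIV. f (axis v 1) * x $ v)" for x
    proof -
      have "f x = f (\<Sum>v\<in>UNIV. x $ v *\<^sub>R axis v 1)"
        using basis_expansion[of x] unfolding scalar_mult_eq_scaleR by (rule arg_cong[OF sym])
      also have "\<dots> = (\<Sum>v\<in>UNIV. f (axis v 1) * x $ v)"
        unfolding f.sum f.scaleR by (simp add: mult.commute)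
      finally show ?thesis .
    qed
    have "\<forall>x. f x = meval x (\<Sum>v\<in>UNIV. mconst (f (axis v 1)) * mvar v)"
      by (simp add: meval.sum meval.mult *[symmetric])
    then show ?case ..
  next
    case (const c)
    show ?case by (metis meval_mconst)
  next
    case (add f g)
    then show ?case by (metis meval.add)
  next
    case (mult f g)
    then show ?case by (metis meval.mult)
  qed
  then show ?thesis using that by blast
qed

lemma meval_approx:
  fixes f :: "real ^ 'v::finite \<Rightarrow> real"
  assumes "compact S" "continuous_on S f" "e > 0"
  obtains p where "\<And>x. x \<in> S \<Longrightarrow> \<bar>f x - meval x p\<bar> < e"
proof -
  obtain g where g: "real_polynomial_function g" "\<And>x. x \<in> S \<Longrightarrow> \<bar>f x - g x\<bar> < e"
    using Stone_Weierstrass_real_polynomial_function[OF assms] by blast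
  then obtain p where "\<And>x. g x = meval x p"
    using real_polynomial_function_meval by blast
  with g(2) show ?thesis using that by metis
qed

section \<open>Positivity on a box\<close>

text \<open>The \<open>j\<close>-th coefficient of the monomial \<open>y ^ k\<close> in the
  Bernstein basis of degree \<open>N\<close>, see \<open>power_bernstein\<close>.\<close>

definition bernstein_ratio :: "nat \<Rightarrow> nat \<Rightarrow> nat \<Rightarrow> real" where
  "bernstein_ratio N j k = real (j choose k) / real (N choose k)"

lemma bernstein_ratio_bounds:
  assumes "j \<le> N"
  shows "0 \<le> bernstein_ratio N j k" "bernstein_ratio N j k \<le> 1"
proof -
  have "j choose k \<le> N choose k"
    using assms by (rule binomial_right_mono)
  then show "0 \<le> bernstein_ratio N j k" "bernstein_ratio N j k \<le> 1"
    by (auto simp: bernstein_ratio_def divide_le_eq_1)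
qed

text \<open>Stated over the reals so that \<open>j < k\<close> is covered as well: there both
  binomial coefficients vanish.\<close>

lemma binomial_Suc_real:
  "real (Suc k) * real (j choose Suc k) = (real j - real k) * real (j choose k)"
proof (cases "k \<le> j")
  case True
  have "Suc k * (j choose Suc k) = (j - k) * (j choose k)"
    by (simp only: binomial_absorption binomial_absorb_comp)
  then show ?thesis
    using True by (simp only: of_nat_mult[symmetric] of_nat_diff[symmetric])
next
  case False
  then show ?thesis by (simp add: binomial_eq_0)
qed

lemma bernstein_ratio_Suc:
  assumes "k < N"
  shows "bernstein_ratio N j (Suc k) = bernstein_ratio N j k * ((real j - real k) / (real N - real k))"
proof -
  have "real (j choose Suc k) = (real j - real k) * real (j choose k) / real (Suc k)"
       "real (N choose Suc k) = (real N - real k) * real (N choose k) / real (Suc k)"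
    using binomial_Suc_real[of k j] binomial_Suc_real[of k N] by (simp_all add: field_simps)
  then show ?thesis by (simp add: bernstein_ratio_def mult_ac del: of_nat_Suc)
qed

text \<open>The ratio is the product of the factors \<open>(j - i) / (N - i)\<close> for
  \<open>i < k\<close>. Each of them differs from \<open>j / N\<close> by at most
  \<open>i / (N - i)\<close>, and since all quantities lie in the unit interval the errors merely
  add up.\<close>

lemma bernstein_ratio_approx:
  assumes "j \<le> N" "k < N"
  shows "\<bar>bernstein_ratio N j k - (real j / real N) ^ k\<bar> \<le> (real k)\<^sup>2 / (real N - real k)"
  using assms(2)
proof (induction k)
  case 0
  then show ?case by (simp add: bernstein_ratio_def)
next
  case (Suc k)
  let ?r = "bernstein_ratio N j k" and ?s = "real j / real N"
  let ?u = "(real j - real k) / (real N - real k)"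
  have N: "real k + 1 < real N" using Suc.prems by linarith
  have jN: "real j \<le> real N" using assms by simp
  have s: "0 \<le> ?s" "?s \<le> 1" using N jN by auto
  have "?u - ?s = - (real k * (real N - real j) / (real N * (real N - real k)))"
    using N by (simp add: field_simps)
  moreover have "real k * (real N - real j) / (real N * (real N - real k)) \<ge> 0"
    using N jN by simp
  moreover have "real k * (real N - real j) / (real N * (real N - real k)) \<le> real k * real N / (real N * (real N - real k))"
    using N by (intro divide_right_mono mult_left_mono) auto
  moreover have "real k * real N / (real N * (real N - real k)) = real k / (real N - real k)"
    using N by simp
  ultimately have us: "\<bar>?u - ?s\<bar> \<le> real k / (real N - real k)" by linarith
  have "bernstein_ratio N j (Suc k) - ?s ^ Suc k = ?r * (?u - ?s) + ?s * (?r - ?s ^ k)"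
    using Suc.prems by (subst bernstein_ratio_Suc) (simp_all add: algebra_simps)
  also have "\<bar>\<dots>\<bar> \<le> \<bar>?r\<bar> * \<bar>?u - ?s\<bar> + \<bar>?s\<bar> * \<bar>?r - ?s ^ k\<bar>"
    by (metis abs_mult abs_triangle_ineq)
  also have "\<dots> \<le> 1 * (real k / (real N - real k)) + 1 * ((real k)\<^sup>2 / (real N - real k))"
    using us s bernstein_ratio_bounds[OF assms(1)] Suc.IH Suc.prems
    by (intro add_mono mult_mono) auto
  also have "\<dots> = (real k + (real k)\<^sup>2) / (real N - real k)"
    by (simp add: add_divide_distrib)
  also have "\<dots> \<le> (real (Suc k))\<^sup>2 / (real N - real (Suc k))"
    using N by (intro frac_le) (auto simp: power2_eq_square algebra_simps)
  finally show ?case .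
qed

text \<open>Expand \<open>y ^ k * (y + (1 - y)) ^ (N - k)\<close> by the binomial theorem; the terms
  with \<open>j < k\<close> may be added because their ratio is zero. The identity holds in the
  polynomial ring, so \<open>y\<close> can be any polynomial.\<close>

lemma power_bernstein:
  fixes y :: "'v mpoly"
  assumes "k \<le> N"
  shows "y ^ k = (\<Sum>j\<le>N. mconst (bernstein_ratio N j k) * (of_nat (N choose j) * y ^ j * (1 - y) ^ (N - j)))"
proof -
  have of_nat: "mconst (real n) = of_nat n" for n
    by (induction n) (simp_all add: mconst.zero mconst.one mconst.add)
  have coef: "mconst (bernstein_ratio N j k) * of_nat (N choose j) = of_nat ((N - k) choose (j - k))"
    if "k \<le> j" "j \<le> N" for j
  proof -
    have "(N choose j) * (j choose k) = (N choose k) * ((N - k) choose (j - k))"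
      using that by (rule choose_mult)
    then have "real (N choose j) * real (j choose k) = real (N choose k) * real ((N - k) choose (j - k))"
      by (metis of_nat_mult)
    then have "bernstein_ratio N j k * real (N choose j) = real ((N - k) choose (j - k))"
      using assms by (simp add: bernstein_ratio_def field_simps)
    then show ?thesis by (metis mconst.mult of_nat)
  qed
  have "y ^ k = y ^ k * (y + (1 - y)) ^ (N - k)" by simp
  also have "\<dots> = (\<Sum>j\<le>N - k. of_nat ((N - k) choose j) * y ^ (j + k) * (1 - y) ^ (N - k - j))"
    by (simp only: binomial_ring sum_distrib_left power_add mult_ac)
  also have "\<dots> = (\<Sum>j\<in>{k..N}. of_nat ((N - k) choose (j - k)) * y ^ j * (1 - y) ^ (N - j))"
    by (rule sum.reindex_bij_witness[of _ "\<lambda>j. j - k" "\<lambda>j. j + k"])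
      (use assms in \<open>auto simp: add.commute\<close>)
  also have "\<dots> = (\<Sum>j\<in>{k..N}. mconst (bernstein_ratio N j k) * (of_nat (N choose j) * y ^ j * (1 - y) ^ (N - j)))"
    by (rule sum.cong) (simp_all add: coef[symmetric] mult.assoc)
  also have "\<dots> = (\<Sum>j\<le>N. mconst (bernstein_ratio N j k) * (of_nat (N choose j) * y ^ j * (1 - y) ^ (N - j)))"
    by (rule sum.mono_neutral_left)
      (auto simp: bernstein_ratio_def binomial_eq_0 not_le mconst.zero)
  finally show ?thesis .
qed

text \<open>What the Bernstein argument requires of a set of certificates; its instance is the
  module of one ball polynomial.\<close>

locale polynomial_semiring =
  fixes T :: "('v::finite) mpoly set"
  assumes add_closed: "p \<in> T \<Longrightarrow> q \<in> T \<Longrightarrow> p + q \<in> T"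
    and mult_closed: "p \<in> T \<Longrightarrow> q \<in> T \<Longrightarrow> p * q \<in> T"
    and mconst_closed: "c \<ge> 0 \<Longrightarrow> mconst c \<in> T"
begin

lemma sum_closed: "(\<And>x. x \<in> A \<Longrightarrow> f x \<in> T) \<Longrightarrow> sum f A \<in> T"
  using mconst_closed[of 0]
  by (induction A rule: infinite_finite_induct)
    (auto simp: add_closed mconst.zero)

lemma prod_closed: "(\<And>x. x \<in> A \<Longrightarrow> f x \<in> T) \<Longrightarrow> prod f A \<in> T"
  using mconst_closed[of 1]
  by (induction A rule: infinite_finite_induct)
    (auto simp: mult_closed mconst.one)

lemma power_closed: "p \<in> T \<Longrightarrow> p ^ n \<in> T"
  using prod_closed[of "{..<n}" "\<lambda>_. p"] by simp

lemma of_nat_closed: "of_nat n \<in> T"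
  using sum_closed[of "{..<n}" "\<lambda>_. 1"] mconst_closed[of 1]
  by (simp add: mconst.one)

text \<open>In the tensor Bernstein basis of degree \<open>N\<close> the coefficients of
  \<open>h\<close> approach its values at the grid points \<open>j / N\<close>, uniformly over the
  grid. These values are bounded below by a positive minimum, so for large \<open>N\<close> all
  coefficients are nonnegative, and every basis element is a product of members of
  \<open>T\<close>.\<close>

lemma positive_on_unit_cube:
  fixes y :: "'v \<Rightarrow> 'v mpoly"
  assumes y: "\<And>v. y v \<in> T" "\<And>v. 1 - y v \<in> T"
    and pos: "\<And>t. (\<And>v. 0 \<le> t $ v \<and> t $ v \<le> 1) \<Longrightarrow> meval t h > 0"
  shows "msubst y h \<in> T"
proof -
  let ?K = "Poly_Mapping.keys h" and ?c = "Poly_Mapping.lookup h"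
  let ?e = "\<lambda>\<alpha>::'v \<Rightarrow>\<^sub>0 nat. Poly_Mapping.lookup \<alpha>"
  \<comment> \<open>Bounds, simultaneously for all grid points, the distance between a Bernstein
    coefficient of \<open>h\<close> and the value of \<open>h\<close> there.\<close>
  define err where "err N = (\<Sum>\<alpha>\<in>?K. \<bar>?c \<alpha>\<bar> * (\<Sum>v\<in>UNIV. (real (?e \<alpha> v))\<^sup>2 / (real N - real (?e \<alpha> v))))" for N
  obtain \<delta> where \<delta>: "\<delta> > 0" "\<And>t. (\<And>v. 0 \<le> t $ v \<and> t $ v \<le> 1) \<Longrightarrow> \<delta> \<le> meval t h"
  proof -
    have box: "t \<in> cbox 0 1 \<longleftrightarrow> (\<forall>v. 0 \<le> t $ v \<and> t $ v \<le> 1)" for t :: "real ^ 'v"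
      by (simp add: mem_box_cart)
    have "(0::real ^ 'v) \<in> cbox 0 1" by (simp add: box)
    then obtain t0 where t0: "t0 \<in> cbox 0 (1::real ^ 'v)" "\<And>t. t \<in> cbox 0 1 \<Longrightarrow> meval t0 h \<le> meval t h"
      using continuous_attains_inf[OF compact_cbox _ continuous_on_meval, of 0 1 h] by blast
    show thesis
      by (rule that[of "meval t0 h"]) (use t0 pos box in auto)
  qed
  have lim: "(\<lambda>N. (real k)\<^sup>2 / (real N - real k)) \<longlonglongrightarrow> 0" for k
    by (intro tendsto_divide_0[OF tendsto_const] filterlim_at_top_imp_at_infinity
        filterlim_tendsto_add_at_top[OF tendsto_const[of "- real k"] filterlim_real_sequentially, simplified])
  have "(\<lambda>N. \<Sum>\<alpha>\<in>?K. \<bar>?c \<alpha>\<bar> * (\<Sum>v\<in>UNIV. (real (?e \<alpha> v))\<^sup>2 / (real N - real (?e \<alpha> v))))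
      \<longlonglongrightarrow> (\<Sum>\<alpha>\<in>?K. \<bar>?c \<alpha>\<bar> * (\<Sum>v\<in>(UNIV::'v set). 0))"
    by (intro tendsto_sum tendsto_mult tendsto_const lim)
  then have "err \<longlonglongrightarrow> 0" by (simp add: err_def[abs_def])
  then have ev1: "\<forall>\<^sub>F N in sequentially. err N < \<delta>"
    using \<delta>(1) by (rule order_tendstoD)
  have "\<forall>\<^sub>F N in sequentially. \<forall>\<alpha>\<in>?K. \<forall>v. ?e \<alpha> v < N"
    by (intro eventually_ball_finite eventually_all_finite ballI finite_keys)
      (rule eventually_gt_at_top)
  with ev1 have "\<forall>\<^sub>F N in sequentially. err N < \<delta> \<and> (\<forall>\<alpha>\<in>?K. \<forall>v. ?e \<alpha> v < N)"
    by (rule eventually_conj)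
  then obtain N where N: "err N < \<delta>" "\<And>\<alpha> v. \<alpha> \<in> ?K \<Longrightarrow> ?e \<alpha> v < N"
    by (auto simp: eventually_sequentially)
  let ?J = "PiE (UNIV :: 'v set) (\<lambda>_. {..N})"
  define b where "b j = (\<Sum>\<alpha>\<in>?K. ?c \<alpha> * (\<Prod>v\<in>UNIV. bernstein_ratio N (j v) (?e \<alpha> v)))" for j :: "'v \<Rightarrow> nat"
  define B where "B v j = of_nat (N choose j) * y v ^ j * (1 - y v) ^ (N - j)" for v j
  have "msubst y h = (\<Sum>\<alpha>\<in>?K. mconst (?c \<alpha>) * (\<Prod>v\<in>UNIV. y v ^ ?e \<alpha> v))"
    by (simp add: msubst_def mhom_def)
  also have "\<dots> = (\<Sum>\<alpha>\<in>?K. mconst (?c \<alpha>) * (\<Prod>v\<in>UNIV. \<Sum>j\<le>N. mconst (bernstein_ratio N j (?e \<alpha> v)) * B v j))"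
  proof (intro sum.cong prod.cong refl arg_cong2[where f = "(*)"])
    fix \<alpha> v assume "\<alpha> \<in> ?K"
    then have "?e \<alpha> v \<le> N" using N(2) by (simp add: less_imp_le)
    then show "y v ^ ?e \<alpha> v = (\<Sum>j\<le>N. mconst (bernstein_ratio N j (?e \<alpha> v)) * B v j)"
      unfolding B_def by (rule power_bernstein)
  qed
  also have "\<dots> = (\<Sum>\<alpha>\<in>?K. mconst (?c \<alpha>) * (\<Sum>j\<in>?J. \<Prod>v\<in>UNIV. mconst (bernstein_ratio N (j v) (?e \<alpha> v)) * B v (j v)))"
    by (subst prod_sum_PiE) auto
  also have "\<dots> = (\<Sum>j\<in>?J. mconst (b j) * (\<Prod>v\<in>UNIV. B v (j v)))"
    unfolding b_def mconst.sum mconst.mult mconst.prod prod.distrib sum_distrib_left sum_distrib_right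
    by (subst sum.swap) (simp add: mult.assoc)
  also have "\<dots> \<in> T"
  proof (intro sum_closed mult_closed prod_closed mconst_closed)
    fix j v
    show "B v (j v) \<in> T"
      unfolding B_def by (intro mult_closed of_nat_closed power_closed y)
  next
    fix j assume "j \<in> ?J"
    then have j: "j v \<le> N" for v by auto
    define t :: "real ^ 'v" where "t = (\<chi> v. real (j v) / real N)"
    \<comment> \<open>For \<open>N = 0\<close> the quotient is zero by convention, so the point
      still lies in the cube.\<close>
    have t: "0 \<le> t $ v \<and> t $ v \<le> 1" for v
      using j[of v] by (cases "N = 0") (auto simp: t_def)
    have "\<bar>b j - meval t h\<bar> = \<bar>\<Sum>\<alpha>\<in>?K. ?c \<alpha> * ((\<Prod>v\<in>UNIV. bernstein_ratio N (j v) (?e \<alpha> v)) - (\<Prod>v\<in>UNIV. (t $ v) ^ ?e \<alpha> v))\<bar>"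
      by (simp add: b_def meval_def mhom_def sum_subtractf right_diff_distrib)
    also have "\<dots> \<le> (\<Sum>\<alpha>\<in>?K. \<bar>?c \<alpha>\<bar> * \<bar>(\<Prod>v\<in>UNIV. bernstein_ratio N (j v) (?e \<alpha> v)) - (\<Prod>v\<in>UNIV. (t $ v) ^ ?e \<alpha> v)\<bar>)"
      by (rule order.trans[OF sum_abs]) (simp add: abs_mult)
    also have "\<dots> \<le> err N"
      unfolding err_def
    proof (intro sum_mono mult_left_mono)
      fix \<alpha> assume \<alpha>: "\<alpha> \<in> ?K"
      have "norm ((\<Prod>v\<in>UNIV. bernstein_ratio N (j v) (?e \<alpha> v)) - (\<Prod>v\<in>UNIV. (t $ v) ^ ?e \<alpha> v))
          \<le> (\<Sum>v\<in>UNIV. norm (bernstein_ratio N (j v) (?e \<alpha> v) - (t $ v) ^ ?e \<alpha> v))"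
        by (rule norm_prod_diff)
          (use bernstein_ratio_bounds[OF j] t in \<open>auto simp: power_le_one\<close>)
      also have "\<dots> \<le> (\<Sum>v\<in>UNIV. (real (?e \<alpha> v))\<^sup>2 / (real N - real (?e \<alpha> v)))"
        using bernstein_ratio_approx[OF j N(2)[OF \<alpha>]]
        by (intro sum_mono) (simp add: t_def)
      finally show "\<bar>(\<Prod>v\<in>UNIV. bernstein_ratio N (j v) (?e \<alpha> v)) - (\<Prod>v\<in>UNIV. (t $ v) ^ ?e \<alpha> v)\<bar>
          \<le> (\<Sum>v\<in>UNIV. (real (?e \<alpha> v))\<^sup>2 / (real N - real (?e \<alpha> v)))" by simp
    qed simp
    finally show "0 \<le> b j" using N(1) \<delta>(2)[OF t] by linarith
  qed
  finally show ?thesis .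
qed

text \<open>The affine map \<open>2 * R * y - R\<close> carries the unit cube onto the box, and
  \<open>y v\<close> and \<open>1 - y v\<close> become positive multiples of the two linear
  generators.\<close>

lemma positive_on_box:
  assumes R: "R > 0" and gen: "\<And>v. mconst R + mvar v \<in> T" "\<And>v. mconst R - mvar v \<in> T"
    and pos: "\<And>x. (\<And>v. \<bar>x $ v\<bar> \<le> R) \<Longrightarrow> meval x h > 0"
  shows "h \<in> T"
proof -
  define y :: "'v \<Rightarrow> 'v mpoly" where "y v = mconst (1 / (2 * R)) * (mconst R + mvar v)" for v
  define k where "k = msubst (\<lambda>v. mconst (2 * R) * mvar v - mconst R) h"
  have c: "mconst (2 * R) * mconst (1 / (2 * R)) = (1 :: 'v mpoly)"
    using R by (simp add: mconst.mult[symmetric] mconst.one)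
  have "1 - y v = mconst (1 / (2 * R)) * (mconst R - mvar v)" for v
  proof -
    have "1 = mconst (1 / (2 * R)) * (mconst R + mconst R)"
      using R by (simp add: mconst.mult[symmetric] mconst.add[symmetric] mconst.one)
    then show ?thesis by (simp add: y_def algebra_simps)
  qed
  then have y: "y v \<in> T" "1 - y v \<in> T" for v
    using R gen by (simp_all add: y_def mult_closed mconst_closed)
  have "msubst y k \<in> T"
  proof (rule positive_on_unit_cube[OF y])
    fix t :: "real ^ 'v" assume t: "\<And>v. 0 \<le> t $ v \<and> t $ v \<le> 1"
    have "\<bar>2 * R * t $ v - R\<bar> \<le> R" for v
      using t[of v] R mult_left_mono[of "t $ v" 1 "2 * R"] by (auto simp: abs_le_iff)
    then show "0 < meval t k"
      unfolding k_def meval_msubst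
      by (intro pos) (simp add: meval.diff meval.mult)
  qed
  moreover have "msubst y k = h"
  proof -
    have "msubst y (mconst (2 * R) * mvar v - mconst R) = mvar v" for v
      using c by (simp add: msubst.diff
          msubst.mult y_def mult.assoc[symmetric])
    then show ?thesis unfolding k_def msubst_msubst by (simp add: msubst_id)
  qed
  ultimately show ?thesis by simp
qed

end

section \<open>Sums of squares and quadratic modules\<close>

lemma sos_zero: "sos 0"
  unfolding sos_def by (rule exI[of _ "[]"]) simp

lemma sos_square: "sos (q ^ 2)"
  unfolding sos_def by (rule exI[of _ "[q]"]) simp

lemma sos_add: "sos p \<Longrightarrow> sos q \<Longrightarrow> sos (p + q)"
  unfolding sos_def by (metis map_append sum_list_append)

lemma sos_sum: "(\<And>x. x \<in> A \<Longrightarrow> sos (f x)) \<Longrightarrow> sos (sum f A)"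
  by (induction A rule: infinite_finite_induct) (auto simp: sos_zero sos_add)

lemma sos_sum_list: "(\<And>x. x \<in> set xs \<Longrightarrow> sos (f x)) \<Longrightarrow> sos (\<Sum>x\<leftarrow>xs. f x)"
  by (induction xs) (auto simp: sos_zero sos_add)

lemma sos_mult:
  assumes "sos p" "sos q"
  shows "sos (p * q)"
proof -
  obtain ps qs where p: "p = (\<Sum>r\<leftarrow>ps. r ^ 2)" and q: "q = (\<Sum>s\<leftarrow>qs. s ^ 2)"
    using assms unfolding sos_def by blast
  have "p * q = (\<Sum>r\<leftarrow>ps. \<Sum>s\<leftarrow>qs. (r * s) ^ 2)"
    by (simp add: p q power_mult_distrib sum_list_const_mult sum_list_mult_const)
  then show ?thesis by (simp add: sos_sum_list sos_square)
qed

lemma sos_mconst: "c \<ge> 0 \<Longrightarrow> sos (mconst c)"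
  using sos_square[of "mconst (sqrt c)"]
  by (simp add: mconst.power[symmetric])

lemma sos_one: "sos 1"
  using sos_square[of 1] by simp

lemma sos_morphism:
  assumes "ring_morphism F" "sos p"
  shows "sos (F p)"
proof -
  obtain ps where "p = (\<Sum>r\<leftarrow>ps. r ^ 2)"
    using assms unfolding sos_def by blast
  then have "F p = (\<Sum>r\<leftarrow>ps. F r ^ 2)"
    by (simp add: ring_morphism.sum_list[OF assms(1)] ring_morphism.power[OF assms(1)])
  then show ?thesis by (simp add: sos_sum_list sos_square)
qed

lemma quadratic_module_sos: "sos s \<Longrightarrow> s \<in> quadratic_module qs"
  unfolding quadratic_module_def
  by (intro CollectI exI[of _ s] exI[of _ "\<lambda>_. 0"]) (simp add: sos_zero)

lemma quadratic_module_generator: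
  assumes "g \<in> set qs"
  shows "g \<in> quadratic_module qs"
proof -
  obtain i where i: "i < length qs" "g = qs ! i"
    using assms by (auto simp: in_set_conv_nth)
  have "(\<Sum>j<length qs. (if j = i then 1 else 0) * qs ! j) = (\<Sum>j<length qs. if j = i then qs ! j else 0)"
    by (rule sum.cong) auto
  then have "(\<Sum>j<length qs. (if j = i then 1 else 0) * qs ! j) = g"
    using i by simp
  then show ?thesis
    unfolding quadratic_module_def
    by (intro CollectI exI[of _ 0] exI[of _ "\<lambda>j. if j = i then 1 else 0"])
      (simp add: sos_zero sos_one)
qed

lemma quadratic_module_add:
  assumes "p \<in> quadratic_module qs" "q \<in> quadratic_module qs"
  shows "p + q \<in> quadratic_module qs"
proof -
  obtain s \<sigma> t \<tau> where *: "p = s + (\<Sum>j<length qs. \<sigma> j * qs ! j)" "q = t + (\<Sum>j<length qs. \<tau> j * qs ! j)"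
    "sos s" "sos t" "\<forall>j<length qs. sos (\<sigma> j)" "\<forall>j<length qs. sos (\<tau> j)"
    using assms unfolding quadratic_module_def by blast
  show ?thesis
    unfolding quadratic_module_def
    by (intro CollectI exI[of _ "s + t"] exI[of _ "\<lambda>j. \<sigma> j + \<tau> j"])
      (use * in \<open>auto simp: sos_add distrib_right sum.distrib\<close>)
qed

lemma quadratic_module_mult:
  assumes "sos r" "p \<in> quadratic_module qs"
  shows "r * p \<in> quadratic_module qs"
proof -
  obtain s \<sigma> where *: "p = s + (\<Sum>j<length qs. \<sigma> j * qs ! j)" "sos s" "\<forall>j<length qs. sos (\<sigma> j)"
    using assms unfolding quadratic_module_def by blast
  show ?thesis
    unfolding quadratic_module_def
    by (intro CollectI exI[of _ "r * s"] exI[of _ "\<lambda>j. r * \<sigma> j"])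
      (use * assms in \<open>auto simp: sos_mult distrib_left sum_distrib_left mult.assoc\<close>)
qed

lemma quadratic_module_sum:
  "(\<And>x. x \<in> A \<Longrightarrow> f x \<in> quadratic_module qs) \<Longrightarrow> sum f A \<in> quadratic_module qs"
  by (induction A rule: infinite_finite_induct)
    (auto simp: quadratic_module_sos sos_zero quadratic_module_add)

text \<open>Morphisms preserve sums of squares, so only the generators have to be checked. This
  carries the ball certificates of \<open>C_a\<close> and \<open>C_x\<close> into the joint
  polynomial ring.\<close>

lemma quadratic_module_morphism:
  assumes F: "ring_morphism F" and sub: "\<And>g. g \<in> set qs \<Longrightarrow> F g \<in> quadratic_module rs"
    and p: "p \<in> quadratic_module qs"
  shows "F p \<in> quadratic_module rs"
proof -
  interpret F: ring_morphism F by fact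
  obtain s \<sigma> where *: "p = s + (\<Sum>j<length qs. \<sigma> j * qs ! j)" "sos s" "\<forall>j<length qs. sos (\<sigma> j)"
    using p unfolding quadratic_module_def by blast
  have "F p = F s + (\<Sum>j<length qs. F (\<sigma> j) * F (qs ! j))"
    by (simp add: * F.add F.sum F.mult)
  also have "\<dots> \<in> quadratic_module rs"
    using * sub
    by (intro quadratic_module_add quadratic_module_sum quadratic_module_mult)
      (auto intro: sos_morphism[OF F] quadratic_module_sos)
  finally show ?thesis .
qed

section \<open>Putinar's Positivstellensatz\<close>

lemma compact_continuous_bounded:
  fixes g :: "'a::topological_space \<Rightarrow> real"
  assumes "compact B" "continuous_on B g"
  obtains G where "G > 0" "\<And>x. x \<in> B \<Longrightarrow> \<bar>g x\<bar> \<le> G"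
proof -
  have "bounded (g ` B)"
    using assms by (intro compact_imp_bounded compact_continuous_image)
  then show thesis using that by (auto simp: bounded_pos)
qed

text \<open>A multiplier has to be a square, so the approximation is applied to
  \<open>sqrt (u x)\<close>, and the error of the square factors as a difference times a
  sum.\<close>

lemma approx_square:
  fixes u :: "real ^ 'v::finite \<Rightarrow> real"
  assumes B: "compact B" and u: "continuous_on B u" "\<And>x. x \<in> B \<Longrightarrow> u x \<ge> 0" and e: "e > 0"
  obtains q where "\<And>x. x \<in> B \<Longrightarrow> \<bar>u x - (meval x q)\<^sup>2\<bar> \<le> e"
proof -
  have cont: "continuous_on B (\<lambda>x. sqrt (u x))"
    using u by (intro continuous_intros)
  obtain S where S: "S > 0" "\<And>x. x \<in> B \<Longrightarrow> \<bar>sqrt (u x)\<bar> \<le> S"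
    using compact_continuous_bounded[OF B cont] by blast
  \<comment> \<open>On \<open>B\<close> the sum of \<open>sqrt (u x)\<close> and its approximation
    is at most \<open>2 * S + e'\<close>, hence at most \<open>2 * S + 1\<close>; this is where the
    cap at 1 is used.\<close>
  define e' where "e' = min 1 (e / (2 * S + 1))"
  have "e' \<le> e / (2 * S + 1)" by (simp add: e'_def)
  then have "e' * (2 * S + 1) \<le> e"
    using S(1) by (simp add: pos_le_divide_eq)
  moreover have "e' > 0" "e' \<le> 1"
    using e S(1) by (simp_all add: e'_def)
  ultimately have e': "e' > 0" "e' \<le> 1" "e' * (2 * S + 1) \<le> e" by auto
  obtain q where q: "\<And>x. x \<in> B \<Longrightarrow> \<bar>sqrt (u x) - meval x q\<bar> < e'"
    using meval_approx[OF B cont e'(1)] by blast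
  show thesis
  proof (rule that[of q])
    fix x assume x: "x \<in> B"
    have "u x - (meval x q)\<^sup>2 = (sqrt (u x) - meval x q) * (sqrt (u x) + meval x q)"
      using u(2)[OF x] by (simp add: algebra_simps power2_eq_square)
    then have "\<bar>u x - (meval x q)\<^sup>2\<bar> = \<bar>sqrt (u x) - meval x q\<bar> * \<bar>sqrt (u x) + meval x q\<bar>"
      by (simp add: abs_mult)
    also have "\<dots> \<le> e' * (2 * S + 1)"
      using q[OF x] S(2)[OF x] e' by (intro mult_mono) linarith+
    finally show "\<bar>u x - (meval x q)\<^sup>2\<bar> \<le> e" using e'(3) by linarith
  qed
qed

text \<open>Wherever \<open>f \<le> 0\<close> some constraint is violated, so on that compact set
  the penalty has a positive minimum. The violations are squared because
  \<open>(max 0 (- g))^2 = - (max 0 (- g) * g)\<close>, which is a multiplier times a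
  constraint.\<close>

lemma positive_penalty:
  fixes f :: "'a::t2_space \<Rightarrow> real" and g :: "'i \<Rightarrow> 'a \<Rightarrow> real"
  assumes B: "compact B" and I: "finite I"
    and f: "continuous_on B f" and g: "\<And>j. j \<in> I \<Longrightarrow> continuous_on B (g j)"
    and pos: "\<And>x. x \<in> B \<Longrightarrow> (\<And>j. j \<in> I \<Longrightarrow> g j x \<ge> 0) \<Longrightarrow> f x > 0"
  obtains c where "c > 0" "\<And>x. x \<in> B \<Longrightarrow> f x + c * (\<Sum>j\<in>I. (max 0 (- g j x))\<^sup>2) > 0"
proof -
  define \<phi> where "\<phi> x = (\<Sum>j\<in>I. (max 0 (- g j x))\<^sup>2)" for x
  have \<phi>: "continuous_on B \<phi>"
    unfolding \<phi>_def[abs_def] using g by (intro continuous_intros) auto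
  have \<phi>0: "\<phi> x \<ge> 0" for x by (simp add: \<phi>_def sum_nonneg)
  define Z where "Z = B \<inter> f -` {..0}"
  have "closedin (top_of_set B) Z"
    unfolding Z_def using f by (rule continuous_closedin_preimage) simp
  then have Z: "compact Z" using B closedin_compact by blast
  have ZB: "Z \<subseteq> B" by (auto simp: Z_def)
  have \<phi>pos: "\<phi> x > 0" if "x \<in> Z" for x
  proof (rule ccontr)
    assume "\<not> \<phi> x > 0"
    then have "\<phi> x = 0" using \<phi>0[of x] by simp
    then have "\<forall>j\<in>I. (max 0 (- g j x))\<^sup>2 = 0"
      unfolding \<phi>_def using I by (simp add: sum_nonneg_eq_0_iff)
    then have "g j x \<ge> 0" if "j \<in> I" for j using that by (auto simp: max_def split: if_splits)
    then have "f x > 0" using pos that ZB by blast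
    then show False using that by (simp add: Z_def)
  qed
  obtain L where L: "L > 0" "\<And>x. x \<in> B \<Longrightarrow> \<bar>f x\<bar> \<le> L"
    using compact_continuous_bounded[OF B f] by blast
  obtain m where m: "m > 0" "\<And>x. x \<in> Z \<Longrightarrow> m \<le> \<phi> x"
  proof (cases "Z = {}")
    case True
    then show thesis using that[of 1] by simp
  next
    case False
    then obtain z where "z \<in> Z" "\<And>x. x \<in> Z \<Longrightarrow> \<phi> z \<le> \<phi> x"
      using continuous_attains_inf[OF Z _ continuous_on_subset[OF \<phi> ZB]] by blast
    then show thesis using that[of "\<phi> z"] \<phi>pos by blast
  qed
  \<comment> \<open>This gives \<open>c * m = L + m\<close>, which exceeds \<open>L\<close> and
    therefore \<open>- f x\<close>.\<close>
  define c where "c = L / m + 1"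
  have c: "c > 0" using L m by (simp add: c_def add_pos_pos)
  have "f x + c * \<phi> x > 0" if x: "x \<in> B" for x
  proof (cases "x \<in> Z")
    case True
    have "c * m \<le> c * \<phi> x" using c m(2)[OF True] by simp
    moreover have "c * m = L + m" using m(1) by (simp add: c_def field_simps)
    ultimately show ?thesis using L(2)[OF x] m(1) by linarith
  next
    case False
    then have "f x > 0" using x by (auto simp: Z_def)
    moreover have "c * \<phi> x \<ge> 0" using c \<phi>0 by simp
    ultimately show ?thesis by linarith
  qed
  then show thesis using that[OF c] by (simp add: \<phi>_def)
qed

text \<open>With the ideal multiplier \<open>c * max 0 (- g)\<close> in place of the square, the
  corrected polynomial is exactly the penalised function \<open>\<psi>\<close>, which is bounded
  away from zero on \<open>B\<close>. Near enough squares keep it positive.\<close>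

lemma positive_modulo_generators:
  fixes f :: "('v::finite) mpoly"
  assumes B: "compact B"
    and pos: "\<And>x. x \<in> B \<Longrightarrow> (\<And>g. g \<in> set gs \<Longrightarrow> meval x g \<ge> 0) \<Longrightarrow> meval x f > 0"
  obtains q where "\<And>x. x \<in> B \<Longrightarrow> meval x (f - (\<Sum>j<length gs. (q j)\<^sup>2 * gs ! j)) > 0"
proof -
  let ?I = "{..<length gs}"
  let ?g = "\<lambda>j x. meval x (gs ! j)"
  obtain c where c: "c > 0" "\<And>x. x \<in> B \<Longrightarrow> meval x f + c * (\<Sum>j\<in>?I. (max 0 (- ?g j x))\<^sup>2) > 0"
  proof (rule positive_penalty[OF B, of ?I "\<lambda>x. meval x f" ?g])
    show "\<And>x. x \<in> B \<Longrightarrow> (\<And>j. j \<in> ?I \<Longrightarrow> 0 \<le> ?g j x) \<Longrightarrow> 0 < meval x f"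
      by (rule pos) (auto simp: in_set_conv_nth)
  qed (auto intro: continuous_on_meval)
  define \<psi> where "\<psi> x = meval x f + c * (\<Sum>j\<in>?I. (max 0 (- ?g j x))\<^sup>2)" for x
  have \<psi>: "continuous_on B \<psi>"
    unfolding \<psi>_def[abs_def] by (intro continuous_intros continuous_on_meval)
  obtain \<delta> where \<delta>: "\<delta> > 0" "\<And>x. x \<in> B \<Longrightarrow> \<delta> \<le> \<psi> x"
  proof (cases "B = {}")
    case True
    then show thesis using that[of 1] by simp
  next
    case False
    then obtain z where "z \<in> B" "\<And>x. x \<in> B \<Longrightarrow> \<psi> z \<le> \<psi> x"
      using continuous_attains_inf[OF B _ \<psi>] by blast
    then show thesis using that[of "\<psi> z"] c by (auto simp: \<psi>_def)
  qed
  \<comment> \<open>The total error over all generators stays strictly below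
    \<open>\<delta>\<close>; the summand 1 in the denominator also covers an empty list. A bound
    \<open>G\<close> on the generator turns accuracy of the multiplier into accuracy of the
    product.\<close>
  have "\<exists>q. \<forall>x\<in>B. \<bar>c * max 0 (- ?g j x) - (meval x q)\<^sup>2\<bar> * \<bar>?g j x\<bar> \<le> \<delta> / (real (length gs) + 1)" for j
  proof -
    obtain G where G: "G > 0" "\<And>x. x \<in> B \<Longrightarrow> \<bar>?g j x\<bar> \<le> G"
      using compact_continuous_bounded[OF B continuous_on_meval[of B "gs ! j"]] by blast
    let ?e = "\<delta> / (real (length gs) + 1) / G"
    obtain q where q: "\<And>x. x \<in> B \<Longrightarrow> \<bar>c * max 0 (- ?g j x) - (meval x q)\<^sup>2\<bar> \<le> ?e"
    proof (rule approx_square[OF B, of "\<lambda>x. c * max 0 (- ?g j x)" ?e])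
      show "?e > 0" using G \<delta> by simp
    qed (use c in \<open>auto intro!: continuous_intros continuous_on_meval\<close>)
    have "\<bar>c * max 0 (- ?g j x) - (meval x q)\<^sup>2\<bar> * \<bar>?g j x\<bar> \<le> ?e * G" if "x \<in> B" for x
      using q[OF that] G(2)[OF that] G(1) \<delta>(1) by (intro mult_mono) auto
    then show ?thesis using G(1) by (auto intro!: exI[of _ q])
  qed
  then obtain q where q: "\<And>j x. x \<in> B \<Longrightarrow>
      \<bar>c * max 0 (- ?g j x) - (meval x (q j))\<^sup>2\<bar> * \<bar>?g j x\<bar> \<le> \<delta> / (real (length gs) + 1)"
    by metis
  show thesis
  proof (rule that[of q])
    fix x assume x: "x \<in> B"
    have "(\<Sum>j\<in>?I. (meval x (q j))\<^sup>2 * ?g j x) \<le> (\<Sum>j\<in>?I. \<delta> / (real (length gs) + 1) - c * (max 0 (- ?g j x))\<^sup>2)"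
    proof (rule sum_mono)
      fix j
      have "((meval x (q j))\<^sup>2 - c * max 0 (- ?g j x)) * ?g j x
          \<le> \<bar>c * max 0 (- ?g j x) - (meval x (q j))\<^sup>2\<bar> * \<bar>?g j x\<bar>"
        by (metis abs_ge_self abs_minus_commute abs_mult)
      moreover have "max 0 (- ?g j x) * ?g j x = - (max 0 (- ?g j x))\<^sup>2"
        by (simp add: max_def power2_eq_square)
      then have "c * max 0 (- ?g j x) * ?g j x = - (c * (max 0 (- ?g j x))\<^sup>2)"
        by (metis mult.assoc mult_minus_right)
      ultimately show "(meval x (q j))\<^sup>2 * ?g j x \<le> \<delta> / (real (length gs) + 1) - c * (max 0 (- ?g j x))\<^sup>2"
        using q[OF x, of j] by (simp add: left_diff_distrib)
    qed
    also have "\<dots> = real (length gs) * (\<delta> / (real (length gs) + 1)) - c * (\<Sum>j\<in>?I. (max 0 (- ?g j x))\<^sup>2)"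
      by (simp add: sum_subtractf sum_distrib_left)
    also have "real (length gs) * (\<delta> / (real (length gs) + 1)) < \<delta>"
      using \<delta>(1) by (simp add: field_simps)
    finally show "meval x (f - (\<Sum>j<length gs. (q j)\<^sup>2 * gs ! j)) > 0"
      using \<delta>(2)[OF x] by (simp add: \<psi>_def meval.diff meval.sum meval.mult meval.power)
  qed
qed

text \<open>
  The quadratic module generated by a single polynomial is closed under multiplication, since
  the square of the generator is a square. For \<open>C - \<parallel>x\<parallel>\<^sup>2\<close> it contains \<open>(C + 1) / 2 \<plusminus> x\<^sub>v\<close>.
\<close>

lemma positive_on_box_in_ball_module:
  fixes h :: "('v::finite) mpoly"
  assumes C: "C > 0"
    and pos: "\<And>x. (\<And>v. \<bar>x $ v\<bar> \<le> (C + 1) / 2) \<Longrightarrow> meval x h > 0"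
  obtains s t where "sos s" "sos t" "h = s + t * (mconst C - (\<Sum>v\<in>UNIV. mvar v ^ 2))"
proof -
  let ?g = "mconst C - (\<Sum>v\<in>UNIV. mvar v ^ 2) :: 'v mpoly"
  define T where "T = {s + t * ?g | s t. sos s \<and> sos t}"
  have TI: "s + t * ?g \<in> T" if "sos s" "sos t" for s t
    using that by (auto simp: T_def)
  have half: "mconst (1/2) * 2 = (1 :: 'v mpoly)"
  proof -
    have "mconst (1/2) * (mconst 1 + mconst 1) = (mconst 1 :: 'v mpoly)"
      unfolding mconst.add[symmetric] mconst.mult[symmetric] by simp
    then show ?thesis by (simp add: mconst.one)
  qed
  have lin: "mconst ((C + 1) / 2) + y \<in> T" if y: "y ^ 2 = mvar v ^ 2" for y :: "'v mpoly" and v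
  proof -
    let ?r = "\<Sum>w\<in>UNIV - {v}. mvar w ^ 2 :: 'v mpoly"
    have sum: "(\<Sum>w\<in>UNIV. mvar w ^ 2) = y ^ 2 + ?r"
      unfolding y by (rule sum.remove) auto
    have "mconst ((C + 1) / 2) = mconst (1/2) * (mconst C + mconst 1 :: 'v mpoly)"
      unfolding mconst.add[symmetric] mconst.mult[symmetric] by simp
    then have "mconst ((C + 1) / 2) + y = mconst (1/2) * (mconst C + 1) + mconst (1/2) * 2 * y"
      by (simp add: half mconst.one)
    \<comment> \<open>Completing the square: since \<open>y ^ 2\<close> is the square of the
      variable, the quadratic terms of \<open>(1 + y) ^ 2 + ?r\<close> and \<open>?g\<close> cancel
      and \<open>C + 1 + 2 * y\<close> remains.\<close>
    also have "\<dots> = mconst (1/2) * ((1 + y) ^ 2 + ?r) + mconst (1/2) * ?g"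
      unfolding sum by (simp add: algebra_simps power2_eq_square)
    also have "\<dots> \<in> T"
      by (intro TI sos_mult sos_add sos_square sos_sum sos_mconst) auto
    finally show ?thesis .
  qed
  interpret polynomial_semiring T
  proof
    fix p q assume "p \<in> T" "q \<in> T"
    then obtain s t s' t' where *: "p = s + t * ?g" "q = s' + t' * ?g" "sos s" "sos t" "sos s'" "sos t'"
      unfolding T_def by blast
    have sum: "p + q = (s + s') + (t + t') * ?g"
      by (simp add: * distrib_right add_ac)
    show "p + q \<in> T" unfolding sum using * by (intro TI sos_add)
    have prod: "p * q = (s * s' + t * t' * ?g ^ 2) + (s * t' + t * s') * ?g"
      by (simp add: * distrib_left distrib_right power2_eq_square ac_simps)
    show "p * q \<in> T" unfolding prod using * by (intro TI sos_add sos_mult sos_square)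
  next
    fix c :: real assume "c \<ge> 0"
    then show "mconst c \<in> T" using TI[OF sos_mconst sos_zero] by simp
  qed
  have "h \<in> T"
  proof (rule positive_on_box[OF _ _ _ pos])
    show "mconst ((C + 1) / 2) - mvar v \<in> T" for v
      using lin[of "- mvar v" v] by simp
  qed (use C lin in auto)
  then show thesis using that by (auto simp: T_def)
qed

text \<open>The correction by square multiples of the generators leaves a polynomial that is
  positive on a whole box, with no constraints. Its certificate involves only the ball polynomial,
  which the Archimedean hypothesis places in the module of \<open>gs\<close>.\<close>

theorem putinar:
  fixes f :: "('v::finite) mpoly"
  assumes arch: "archimedean_module (quadratic_module gs)"
    and pos: "\<And>x. (\<And>g. g \<in> set gs \<Longrightarrow> meval x g \<ge> 0) \<Longrightarrow> meval x f > 0"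
  shows "f \<in> quadratic_module gs"
proof -
  obtain C where C: "C > 0" "mconst C - (\<Sum>v\<in>UNIV. mvar v ^ 2) \<in> quadratic_module gs"
    using arch unfolding archimedean_module_def by blast
  \<comment> \<open>The half-width for which the module of the ball polynomial contains the linear
    polynomials bounding the box.\<close>
  let ?R = "(C + 1) / 2"
  have box: "x \<in> cbox (\<chi> v. - ?R) (\<chi> v. ?R) \<longleftrightarrow> (\<forall>v. \<bar>x $ v\<bar> \<le> ?R)" for x :: "real ^ 'v"
  proof -
    have "- ?R \<le> x $ v \<and> x $ v \<le> ?R \<longleftrightarrow> \<bar>x $ v\<bar> \<le> ?R" for v by linarith
    then show ?thesis by (simp add: mem_box_cart)
  qed
  obtain q where q: "\<And>x. x \<in> cbox (\<chi> v. - ?R) (\<chi> v. ?R) \<Longrightarrow>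
      meval x (f - (\<Sum>j<length gs. (q j)\<^sup>2 * gs ! j)) > 0"
    using positive_modulo_generators[OF compact_cbox, where f = f and gs = gs] pos by blast
  obtain s t where st: "sos s" "sos t"
    "f - (\<Sum>j<length gs. (q j)\<^sup>2 * gs ! j) = s + t * (mconst C - (\<Sum>v\<in>UNIV. mvar v ^ 2))"
    using positive_on_box_in_ball_module[OF C(1)] q box by blast
  have "f = s + t * (mconst C - (\<Sum>v\<in>UNIV. mvar v ^ 2)) + (\<Sum>j<length gs. (q j)\<^sup>2 * gs ! j)"
    using st(3) by (simp add: algebra_simps)
  also have "\<dots> \<in> quadratic_module gs"
  proof (intro quadratic_module_add quadratic_module_sum)
    show "s \<in> quadratic_module gs"
      using st(1) by (rule quadratic_module_sos)
    show "t * (mconst C - (\<Sum>v\<in>UNIV. mvar v ^ 2)) \<in> quadratic_module gs"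
      using st(2) C(2) by (rule quadratic_module_mult)
    show "(q j)\<^sup>2 * gs ! j \<in> quadratic_module gs" if "j \<in> {..<length gs}" for j
      using that by (intro quadratic_module_mult sos_square quadratic_module_generator) simp
  qed
  finally show ?thesis .
qed

section \<open>Feasibility of strict upper bounds\<close>

text \<open>The clauses of \<open>R_I\<close> are matched with their encodings: an assignment
  becomes a substitution, and a guard \<open>\<ge> 0\<close> a negated generator.\<close>

lemma R_I_subset:
  fixes P :: "('m::finite, 'n::finite) problem"
  assumes "i \<le> num_branches P + 1"
  shows "R_I P i \<subseteq> {a \<in> C_a P. \<forall>x\<in>K P i a. meval2 a x (concl P i) \<le> 0}"
proof -
  have neg: "meval2 a x (- p) = - meval2 a x p" for a x and p :: "('m + 'n) mpoly"
    by (simp add: meval2_eq meval.uminus)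
  consider "i = 0" | "0 < i" "i \<le> num_branches P" | "i = num_branches P + 1"
    using assms by linarith
  then show ?thesis
  proof cases
    case 1
    then show ?thesis by (auto simp: R_I_def K_def premise_def concl_def)
  next
    case 2
    then show ?thesis
      by (auto simp: R_I_def K_def premise_def concl_def guard_le_def assign_def meval2_subst_x)
  next
    case 3
    then show ?thesis
      by (auto simp: R_I_def K_def premise_def concl_def guard_ge_def neg atLeastLessThanSuc_atLeastAtMost
          simp del: upt_Suc)
  qed
qed

section \<open>One quadratic module for parameters and states together\<close>

lemma join_vec_surj:
  obtains a x where "z = join_vec a x"
proof
  show "z = join_vec (\<chi> u. z $ Inl u) (\<chi> v. z $ Inr v)"
    by (auto simp: join_vec_def vec_eq_iff split: sum.split)
qed

lemma sum_lessThan_add: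
  fixes f :: "nat \<Rightarrow> 'a::comm_monoid_add"
  shows "(\<Sum>j<m + n. f j) = (\<Sum>j<m. f j) + (\<Sum>j<n. f (m + j))"
  by (induction n) (simp_all add: add.assoc)

text \<open>The signs change because constraints are \<open>\<le> 0\<close> and generators
  \<open>\<ge> 0\<close>. The order of the three blocks is that of the multiplier families in
  \<open>representation\<close>.\<close>

definition joint_generators :: "('m::finite, 'n::finite) problem \<Rightarrow> nat \<Rightarrow> ('m + 'n) mpoly list" where
  "joint_generators P i = map uminus (premise P i @ map emb_a (ha P) @ map emb_x (hx P))"

lemma joint_generators_nonneg:
  fixes P :: "('m::finite, 'n::finite) problem"
  assumes "\<And>g. g \<in> set (joint_generators P i) \<Longrightarrow> meval (join_vec a x) g \<ge> 0"
  shows "a \<in> C_a P" "x \<in> K P i a"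
proof -
  have *: "meval (join_vec a x) p \<le> 0"
    if "p \<in> set (premise P i) \<union> emb_a ` set (ha P) \<union> emb_x ` set (hx P)" for p
    using assms[of "- p"] that
    by (auto simp: joint_generators_def meval.uminus)
  have "meval a h \<le> 0" if "h \<in> set (ha P)" for h
    using *[of "emb_a h"] that by (simp add: meval2_eq[symmetric])
  moreover have "meval x h \<le> 0" if "h \<in> set (hx P)" for h
    using *[of "emb_x h"] that by (simp add: meval2_eq[symmetric])
  ultimately show "a \<in> C_a P" "x \<in> K P i a"
    using * by (auto simp: C_a_def K_def C_x_def meval2_eq)
qed

text \<open>The embeddings send generators to joint generators, so the certificates
  \<open>C - |a|^2\<close> and \<open>D - |x|^2\<close> both lie in the joint module, and their sum
  is the ball polynomial of \<open>(a, x)\<close> with constant \<open>C + D\<close>.\<close>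

lemma joint_archimedean:
  fixes P :: "('m::finite, 'n::finite) problem"
  assumes "archimedean_module (quadratic_module (map uminus (ha P)))"
    and "archimedean_module (quadratic_module (map uminus (hx P)))"
  shows "archimedean_module (quadratic_module (joint_generators P i))"
proof -
  let ?Q = "quadratic_module (joint_generators P i)"
  obtain C where C: "C > 0" "mconst C - (\<Sum>u\<in>UNIV. mvar u ^ 2) \<in> quadratic_module (map uminus (ha P))"
    using assms(1) unfolding archimedean_module_def by blast
  obtain D where D: "D > 0" "mconst D - (\<Sum>v\<in>UNIV. mvar v ^ 2) \<in> quadratic_module (map uminus (hx P))"
    using assms(2) unfolding archimedean_module_def by blast
  have "emb_a (mconst C - (\<Sum>u\<in>UNIV. mvar u ^ 2)) \<in> ?Q"
    unfolding emb_a_def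
    by (rule quadratic_module_morphism[OF ring_morphism_msubst _ C(2)],
        rule quadratic_module_generator)
      (auto simp: joint_generators_def emb_a_def msubst.diff msubst.sum msubst.power msubst.uminus)
  moreover have "emb_x (mconst D - (\<Sum>v\<in>UNIV. mvar v ^ 2)) \<in> ?Q"
    unfolding emb_x_def
    by (rule quadratic_module_morphism[OF ring_morphism_msubst _ D(2)],
        rule quadratic_module_generator)
      (auto simp: joint_generators_def emb_x_def msubst.diff msubst.sum msubst.power msubst.uminus)
  ultimately have "emb_a (mconst C - (\<Sum>u\<in>UNIV. mvar u ^ 2)) + emb_x (mconst D - (\<Sum>v\<in>UNIV. mvar v ^ 2)) \<in> ?Q"
    by (rule quadratic_module_add)
  also have "emb_a (mconst C - (\<Sum>u\<in>UNIV. mvar u ^ 2)) + emb_x (mconst D - (\<Sum>v\<in>UNIV. mvar v ^ 2))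
      = mconst (C + D) - ((\<Sum>u\<in>UNIV. mvar (Inl u) ^ 2) + (\<Sum>v\<in>UNIV. mvar (Inr v :: 'm + 'n) ^ 2))"
    by (simp add: emb_a_def emb_x_def msubst.diff msubst.sum msubst.power msubst.uminus mconst.add)
  also have "(\<Sum>u\<in>UNIV. mvar (Inl u) ^ 2) + (\<Sum>v\<in>UNIV. mvar (Inr v :: 'm + 'n) ^ 2) = (\<Sum>v\<in>UNIV. mvar v ^ 2)"
    unfolding UNIV_sum by (subst sum.union_disjoint) (auto simp: sum.reindex)
  finally show ?thesis
    unfolding archimedean_module_def using C(1) D(1) by (intro exI[of _ "C + D"]) auto
qed

lemma eventually_deg_le: "\<forall>\<^sub>F d in sequentially. deg_le (2 * d) p"
  unfolding deg_le_def
proof (intro eventually_ball_finite finite_keys ballI)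
  fix \<alpha>
  show "\<forall>\<^sub>F d in sequentially. mon_deg \<alpha> \<le> 2 * d"
    using eventually_ge_at_top[of "mon_deg \<alpha>"] by eventually_elim simp
qed

text \<open>The single list of multipliers is cut at the block boundaries. It consists of finitely
  many fixed polynomials, so the degree bound \<open>2 * d\<close> holds for all of them once
  \<open>d\<close> is large.\<close>

lemma joint_module_representation:
  fixes P :: "('m::finite, 'n::finite) problem"
  assumes "f \<in> quadratic_module (joint_generators P i)"
  obtains s where "f = representation P i s" "\<forall>\<^sub>F d in sequentially. valid_multipliers P d i s"
proof -
  let ?A = "premise P i" and ?B = "map emb_a (ha P) :: ('m + 'n) mpoly list"
    and ?C = "map emb_x (hx P) :: ('m + 'n) mpoly list"
  let ?L = "joint_generators P i"
  let ?n = "length ?A" and ?m = "length ?B"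
  obtain \<sigma>0 \<sigma> where f: "f = \<sigma>0 + (\<Sum>j<length ?L. \<sigma> j * ?L ! j)"
    and sos: "sos \<sigma>0" "\<forall>j<length ?L. sos (\<sigma> j)"
    using assms unfolding quadratic_module_def by blast
  define s where "s = \<lparr>mult0 = \<sigma>0, multK = \<sigma>, multa = (\<lambda>r. \<sigma> (?n + r)), multx = (\<lambda>r. \<sigma> (?n + (?m + r)))\<rparr>"
  have len: "length ?L = ?n + (?m + length ?C)" by (simp add: joint_generators_def)
  have nth: "?L ! r = - (?A ! r)" if "r < ?n" for r
    using that by (simp add: joint_generators_def nth_append)
  have nth': "?L ! (?n + r) = - emb_a (ha P ! r)" if "r < ?m" for r
    using that by (simp add: joint_generators_def nth_append)
  have nth'': "?L ! (?n + (?m + r)) = - emb_x (hx P ! r)" if "r < length ?C" for r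
    using that by (simp add: joint_generators_def nth_append)
  have "f = representation P i s"
    unfolding f len sum_lessThan_add representation_def s_def
    by (simp add: nth nth'[simplified] nth''[simplified] sum_negf)
  moreover have "\<forall>\<^sub>F d in sequentially. valid_multipliers P d i s"
  proof -
    have ev: "\<forall>\<^sub>F d in sequentially. \<forall>r<k. sos (\<tau> r) \<and> deg_le (2 * d) (\<tau> r)"
      if "\<forall>r<k. sos (\<tau> r)" for \<tau> :: "nat \<Rightarrow> ('m + 'n) mpoly" and k
    proof -
      have "\<forall>\<^sub>F d in sequentially. \<forall>r\<in>{..<k}. deg_le (2 * d) (\<tau> r)"
        by (intro eventually_ball_finite ballI eventually_deg_le) simp
      then show ?thesis by eventually_elim (use that in auto)
    qed
    show ?thesis
      unfolding valid_multipliers_def Let_def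
      by (intro eventually_conj ev eventually_deg_le always_eventually allI)
        (use sos in \<open>auto simp: s_def len\<close>)
  qed
  ultimately show thesis using that by blast
qed

lemma positive_in_joint_module:
  fixes P :: "('m::finite, 'n::finite) problem"
  assumes "archimedean_module (quadratic_module (map uminus (ha P)))"
    and "archimedean_module (quadratic_module (map uminus (hx P)))"
    and pos: "\<And>a x. a \<in> C_a P \<Longrightarrow> x \<in> K P i a \<Longrightarrow> meval2 a x f > 0"
  shows "f \<in> quadratic_module (joint_generators P i)"
proof (rule putinar[OF joint_archimedean[OF assms(1,2)]])
  fix z :: "real ^ ('m + 'n)"
  assume z: "\<And>g. g \<in> set (joint_generators P i) \<Longrightarrow> meval z g \<ge> 0"
  obtain a x where zz: "z = join_vec a x" by (rule join_vec_surj)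
  show "meval z f > 0"
    using joint_generators_nonneg[OF z[unfolded zz]] pos[of a x] by (simp add: zz meval2_eq)
qed

text \<open>The strict inequalities are what \<open>putinar\<close> asks for. The resulting point
  does not depend on \<open>d\<close>, so one and the same point competes in all programs of large
  degree.\<close>

lemma feasible_strict_upper_bound:
  fixes P :: "('m::finite, 'n::finite) problem"
  assumes ha: "archimedean_module (quadratic_module (map uminus (ha P)))"
    and hx: "archimedean_module (quadratic_module (map uminus (hx P)))"
    and l: "\<And>a x. a \<in> C_a P \<Longrightarrow> x \<in> K P i a \<Longrightarrow> meval2 a x (concl P i) < meval a q"
    and M: "\<And>a. a \<in> C_a P \<Longrightarrow> - M < meval a q"
  obtains s where "bound_poly s = q" "\<forall>\<^sub>F d in sequentially. feasible P M d i s"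
proof -
  note put = positive_in_joint_module[OF ha hx]
  have "meval2 a x (emb_a q - concl P i) = meval a q - meval2 a x (concl P i)" for a x
    unfolding meval2_eq meval.diff by (simp add: meval2_eq[symmetric])
  then have "emb_a q - concl P i \<in> quadratic_module (joint_generators P i)"
    using l by (intro put) simp
  then obtain s where s: "emb_a q - concl P i = representation P i s"
    "\<forall>\<^sub>F d in sequentially. valid_multipliers P d i s"
    by (rule joint_module_representation)
  have "0 < meval2 a x (emb_a q + mconst M)" if "a \<in> C_a P" for a x
  proof -
    have "meval2 a x (emb_a q + mconst M) = meval a q + M"
      unfolding meval2_eq meval.add by (simp add: meval2_eq[symmetric])
    then show ?thesis using M[OF that] by simp
  qed
  then have "emb_a q + mconst M \<in> quadratic_module (joint_generators P i)"
    by (intro put)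
  then obtain s' where s': "emb_a q + mconst M = representation P i s'"
    "\<forall>\<^sub>F d in sequentially. valid_multipliers P d i s'"
    by (rule joint_module_representation)
  have "\<forall>\<^sub>F d in sequentially. feasible P M d i \<lparr>bound_poly = q, mults = s, mults' = s'\<rparr>"
    using s(2) s'(2) eventually_deg_le[of q]
    by eventually_elim (simp add: feasible_def s(1) s'(1))
  from that[OF _ this] show thesis by simp
qed

text \<open>A certificate of \<open>q\<close> can be added to both identities at once, since
  \<open>q\<close> enters them in the same way. Used to perturb an optimal point in
  \<open>empty_fibres_null\<close>.\<close>

lemma feasible_add:
  fixes P :: "('m::finite, 'n::finite) problem"
  assumes s: "feasible P M d i s" and q: "deg_le (2 * d) q"
    and r: "valid_multipliers P d i r" "emb_a q = representation P i r"
  obtains s' where "feasible P M d i s'" "bound_poly s' = bound_poly s + q"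
proof -
  have deg: "deg_le D (p + p')" if "deg_le D p" "deg_le D p'" for D and p p' :: "'v::finite mpoly"
    using that keys_add[of p p'] unfolding deg_le_def by blast
  define add :: "('m, 'n) multipliers \<Rightarrow> ('m, 'n) multipliers" where
    "add u = \<lparr>mult0 = mult0 u + mult0 r, multK = (\<lambda>j. multK u j + multK r j),
      multa = (\<lambda>j. multa u j + multa r j), multx = (\<lambda>j. multx u j + multx r j)\<rparr>" for u
  have valid: "valid_multipliers P d i (add u)" if "valid_multipliers P d i u" for u
    using that r(1) by (simp add: valid_multipliers_def Let_def add_def sos_add deg)
  have rep: "representation P i (add u) = representation P i u + emb_a q" for u
    unfolding r(2) representation_def add_def
    by (simp add: distrib_right sum.distrib)
  have emb: "emb_a (bound_poly s + q) = emb_a (bound_poly s) + (emb_a q :: ('m + 'n) mpoly)"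
    by (simp add: emb_a_def msubst.add)
  have identities: "emb_a (bound_poly s + q) - concl P i = emb_a (bound_poly s) - concl P i + emb_a q"
    "emb_a (bound_poly s + q) + mconst M = (emb_a (bound_poly s) + mconst M + emb_a q :: ('m + 'n) mpoly)"
    unfolding emb by simp_all
  show thesis
    by (rule that[of "\<lparr>bound_poly = bound_poly s + q, mults = add (mults s), mults' = add (mults' s)\<rparr>"])
      (use s q in \<open>simp_all add: feasible_def valid rep identities deg\<close>)
qed

lemma representation_nonneg:
  fixes P :: "('m::finite, 'n::finite) problem"
  assumes "valid_multipliers P d i s" "a \<in> C_a P" "x \<in> K P i a"
  shows "meval2 a x (representation P i s) \<ge> 0"
proof -
  have sos: "meval z q \<ge> 0" if "sos q" for z and q :: "('m + 'n) mpoly"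
    using that unfolding sos_def by (auto simp: meval.sum_list meval.power intro!: sum_list_nonneg)
  have neg: "(\<Sum>r<k. meval (join_vec a x) (\<tau> r) * meval (join_vec a x) (g r)) \<le> 0"
    if "\<forall>r<k. sos (\<tau> r) \<and> deg_le (2 * d) (\<tau> r)" "\<And>r. r < k \<Longrightarrow> meval2 a x (g r) \<le> 0"
    for k and \<tau> g :: "nat \<Rightarrow> ('m + 'n) mpoly"
    using that by (intro sum_nonpos mult_nonneg_nonpos sos) (auto simp: meval2_eq)
  note valid = assms(1)[unfolded valid_multipliers_def Let_def]
  have "(\<Sum>r<length (premise P i). meval (join_vec a x) (multK s r) * meval (join_vec a x) (premise P i ! r)) \<le> 0"
    using valid assms(3) by (intro neg) (auto simp: K_def)
  moreover have "(\<Sum>r<length (ha P). meval (join_vec a x) (multa s r) * meval (join_vec a x) (emb_a (ha P ! r))) \<le> 0"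
    using valid assms(2) by (intro neg) (auto simp: C_a_def)
  moreover have "(\<Sum>r<length (hx P). meval (join_vec a x) (multx s r) * meval (join_vec a x) (emb_x (hx P ! r))) \<le> 0"
    using valid assms(3) by (intro neg) (auto simp: K_def C_x_def)
  moreover have "meval (join_vec a x) (mult0 s) \<ge> 0"
    using valid by (simp add: sos)
  ultimately show ?thesis
    unfolding representation_def meval2_eq
    by (simp add: meval.diff meval.sum meval.mult)
qed

section \<open>Upper envelopes\<close>

text \<open>
  The penalised supremum is \<open>c\<close>-Lipschitz in \<open>a\<close> and decreases to the supremum over the fibre
  above \<open>a\<close> as \<open>c\<close> grows. Inserting the value \<open>m\<close> takes care of empty fibres.
\<close>

definition fibre_sup :: "('a \<times> 'b) set \<Rightarrow> ('a \<times> 'b \<Rightarrow> real) \<Rightarrow> real \<Rightarrow> 'a \<Rightarrow> real" where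
  "fibre_sup S l m a = Sup (insert m (l ` {z \<in> S. fst z = a}))"

definition penalty_sup :: "('a::metric_space \<times> 'b) set \<Rightarrow> ('a \<times> 'b \<Rightarrow> real) \<Rightarrow> real \<Rightarrow> real \<Rightarrow> 'a \<Rightarrow> real" where
  "penalty_sup S l m c a = Sup (insert m ((\<lambda>z. l z - c * dist a (fst z)) ` S))"

locale upper_envelope =
  fixes S :: "('a::metric_space \<times> 'b::metric_space) set" and l :: "'a \<times> 'b \<Rightarrow> real" and m :: real
  assumes compact: "compact S" and cont: "continuous_on S l"
begin

lemma bounded_above:
  obtains L where "L \<ge> m" "\<And>z. z \<in> S \<Longrightarrow> l z \<le> L"
proof -
  obtain G where "\<And>z. z \<in> S \<Longrightarrow> \<bar>l z\<bar> \<le> G"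
    using compact_continuous_bounded[OF compact cont] by blast
  then have "\<And>z. z \<in> S \<Longrightarrow> l z \<le> max m G" by (metis abs_le_D1 max.coboundedI2)
  then show thesis using that[of "max m G"] by simp
qed

lemma fibre_sup_bdd: "bdd_above (insert m (l ` {z \<in> S. fst z = a}))"
proof -
  obtain L where "L \<ge> m" "\<And>z. z \<in> S \<Longrightarrow> l z \<le> L" by (rule bounded_above) blast
  then show ?thesis by (auto intro!: bdd_aboveI2)
qed

lemma penalty_sup_bdd:
  assumes "c \<ge> 0"
  shows "bdd_above (insert m ((\<lambda>z. l z - c * dist a (fst z)) ` S))"
proof -
  obtain L where L: "L \<ge> m" "\<And>z. z \<in> S \<Longrightarrow> l z \<le> L" by (rule bounded_above) blast
  have "l z - c * dist a (fst z) \<le> L" if "z \<in> S" for z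
    using L(2)[OF that] mult_nonneg_nonneg[OF assms zero_le_dist, of a "fst z"] by linarith
  then show ?thesis by (auto intro!: bdd_aboveI2)
qed

lemma fibre_sup_ge: "m \<le> fibre_sup S l m a"
  unfolding fibre_sup_def by (rule cSup_upper[OF _ fibre_sup_bdd]) simp

lemma fibre_sup_upper: "z \<in> S \<Longrightarrow> fst z = a \<Longrightarrow> l z \<le> fibre_sup S l m a"
  unfolding fibre_sup_def by (rule cSup_upper[OF _ fibre_sup_bdd]) auto

lemma fibre_sup_le:
  assumes "m \<le> t" "\<And>z. z \<in> S \<Longrightarrow> fst z = a \<Longrightarrow> l z \<le> t"
  shows "fibre_sup S l m a \<le> t"
  unfolding fibre_sup_def by (rule cSup_least) (use assms in auto)

lemma penalty_sup_ge: "c \<ge> 0 \<Longrightarrow> m \<le> penalty_sup S l m c a"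
  unfolding penalty_sup_def by (rule cSup_upper[OF _ penalty_sup_bdd]) auto

lemma penalty_sup_upper: "c \<ge> 0 \<Longrightarrow> z \<in> S \<Longrightarrow> l z - c * dist a (fst z) \<le> penalty_sup S l m c a"
  unfolding penalty_sup_def by (rule cSup_upper[OF _ penalty_sup_bdd]) auto

lemma penalty_sup_le:
  assumes "m \<le> t" "\<And>z. z \<in> S \<Longrightarrow> l z - c * dist a (fst z) \<le> t"
  shows "penalty_sup S l m c a \<le> t"
  unfolding penalty_sup_def by (rule cSup_least) (use assms in auto)

lemma fibre_sup_le_penalty_sup:
  assumes "c \<ge> 0"
  shows "fibre_sup S l m a \<le> penalty_sup S l m c a"
proof (rule fibre_sup_le)
  show "m \<le> penalty_sup S l m c a" using assms by (rule penalty_sup_ge)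
  show "l z \<le> penalty_sup S l m c a" if "z \<in> S" "fst z = a" for z
    using penalty_sup_upper[OF assms that(1), of a] that(2) by simp
qed

lemma penalty_sup_lipschitz:
  assumes c: "c \<ge> 0"
  shows "penalty_sup S l m c a \<le> penalty_sup S l m c b + c * dist a b"
proof (rule penalty_sup_le)
  have "0 \<le> c * dist a b" using c by simp
  then show "m \<le> penalty_sup S l m c b + c * dist a b"
    using penalty_sup_ge[OF c, of b] by linarith
  fix z assume z: "z \<in> S"
  have "c * dist b (fst z) \<le> c * (dist a b + dist a (fst z))"
    using c by (intro mult_left_mono) (simp_all add: dist_triangle3 dist_commute)
  then show "l z - c * dist a (fst z) \<le> penalty_sup S l m c b + c * dist a b"
    using penalty_sup_upper[OF c z, of b] by (simp add: distrib_left)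
qed

lemma continuous_penalty_sup:
  assumes c: "c \<ge> 0"
  shows "continuous_on X (penalty_sup S l m c)"
proof -
  have "c-lipschitz_on X (penalty_sup S l m c)"
  proof (rule lipschitz_onI)
    fix a b
    show "dist (penalty_sup S l m c a) (penalty_sup S l m c b) \<le> c * dist a b"
      using penalty_sup_lipschitz[OF c, of a b] penalty_sup_lipschitz[OF c, of b a]
      by (simp add: dist_real_def dist_commute)
  qed (rule c)
  then show ?thesis by (rule lipschitz_on_continuous_on)
qed

text \<open>For \<open>t\<close> above the fibre supremum, the points of \<open>S\<close> with
  \<open>l \<ge> t\<close> form a compact set that misses the fibre, so they keep a distance
  \<open>\<delta>\<close> from it. As soon as \<open>n * \<delta> \<ge> L - t\<close>, the penalty
  pushes all of them down to \<open>t\<close>.\<close>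

lemma penalty_sup_tendsto: "(\<lambda>n. penalty_sup S l m (real n) a) \<longlonglongrightarrow> fibre_sup S l m a"
proof (rule order_tendstoI)
  fix y assume "y < fibre_sup S l m a"
  then show "\<forall>\<^sub>F n in sequentially. y < penalty_sup S l m (real n) a"
    using fibre_sup_le_penalty_sup[of _ a] by (intro always_eventually allI) (meson less_le_trans of_nat_0_le_iff)
next
  fix y assume y: "fibre_sup S l m a < y"
  \<comment> \<open>A midpoint, because a supremum of values at most \<open>t\<close> is only known
    to be at most \<open>t\<close>, while a strict bound by \<open>y\<close> is wanted.\<close>
  define t where "t = (fibre_sup S l m a + y) / 2"
  have t: "fibre_sup S l m a < t" "t < y" using y by (auto simp: t_def)
  define Z where "Z = S \<inter> l -` {t..}"
  have "closedin (top_of_set S) Z"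
    unfolding Z_def using cont by (rule continuous_closedin_preimage) simp
  then have Z: "Topological_Spaces.compact Z" using compact closedin_compact by blast
  have pos: "dist a (fst z) > 0" if "z \<in> Z" for z
    using fibre_sup_upper[of z a] that t by (auto simp: Z_def)
  obtain \<delta> where \<delta>: "\<delta> > 0" "\<And>z. z \<in> Z \<Longrightarrow> \<delta> \<le> dist a (fst z)"
  proof (cases "Z = {}")
    case True
    then show thesis using that[of 1] by simp
  next
    case False
    have "continuous_on Z (\<lambda>z. dist a (fst z))" by (intro continuous_intros)
    then obtain z where "z \<in> Z" "\<And>w. w \<in> Z \<Longrightarrow> dist a (fst z) \<le> dist a (fst w)"
      using continuous_attains_inf[OF Z False] by blast
    then show thesis using that[of "dist a (fst z)"] pos by blast
  qed
  obtain L where L: "L \<ge> m" "\<And>z. z \<in> S \<Longrightarrow> l z \<le> L" by (rule bounded_above) blast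
  have "\<forall>\<^sub>F n in sequentially. (L - t) / \<delta> \<le> real n"
    using filterlim_real_sequentially by (rule filterlim_at_top[THEN iffD1, rule_format])
  then show "\<forall>\<^sub>F n in sequentially. penalty_sup S l m (real n) a < y"
  proof eventually_elim
    fix n assume "(L - t) / \<delta> \<le> real n"
    then have n: "L - t \<le> real n * \<delta>" using \<delta>(1) by (simp add: pos_divide_le_eq)
    have "penalty_sup S l m (real n) a \<le> t"
    proof (rule penalty_sup_le)
      show "m \<le> t" using fibre_sup_ge[of a] t by linarith
      fix z assume z: "z \<in> S"
      show "l z - real n * dist a (fst z) \<le> t"
      proof (cases "z \<in> Z")
        case True
        then have "real n * \<delta> \<le> real n * dist a (fst z)" using \<delta>(2) by (intro mult_left_mono) auto
        then show ?thesis using n L(2)[OF z] by linarith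
      next
        case False
        then have "l z < t" using z by (auto simp: Z_def)
        moreover have "0 \<le> real n * dist a (fst z)" by simp
        ultimately show ?thesis by linarith
      qed
    qed
    then show "penalty_sup S l m (real n) a < y" using t by linarith
  qed
qed

end

section \<open>Convergence in mean and sublevel sets\<close>

text \<open>The set is covered by \<open>{f = 0}\<close>, which is null, by a strip
  \<open>- \<delta> < f < 0\<close>, which is small by continuity from above because the strips
  shrink to the empty set, and by points with \<open>f \<le> - \<delta>\<close> and
  \<open>p > 0\<close>. At the latter \<open>p - f \<ge> \<delta>\<close>, so Markov's inequality
  applies.\<close>

lemma (in finite_measure) sublevel_difference_tendsto:
  fixes f :: "'a \<Rightarrow> real" and p :: "nat \<Rightarrow> 'a \<Rightarrow> real"
  assumes f: "integrable M f" and p: "\<And>d. integrable M (p d)"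
    and ge: "\<And>d. AE x in M. f x \<le> p d x"
    and mean: "\<And>\<epsilon>. \<epsilon> > 0 \<Longrightarrow> \<forall>\<^sub>F d in sequentially. integral\<^sup>L M (p d) \<le> integral\<^sup>L M f + \<epsilon>"
    and null: "measure M {x \<in> space M. f x = 0} = 0"
  shows "(\<lambda>d. measure M {x \<in> space M. f x \<le> 0 \<and> p d x > 0}) \<longlonglongrightarrow> 0"
proof (rule order_tendstoI)
  have [measurable]: "f \<in> borel_measurable M" "\<And>d. p d \<in> borel_measurable M"
    using f p by auto
  fix \<eta> :: real assume \<eta>: "\<eta> > 0"
  define E where "E k = {x \<in> space M. - (1 / real (Suc k)) < f x \<and> f x < 0}" for k
  have E[measurable]: "E k \<in> sets M" for k unfolding E_def by measurable
  have "decseq E"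
  proof (rule decseq_SucI)
    fix k
    have "1 / real (Suc (Suc k)) \<le> 1 / real (Suc k)" by (simp add: field_simps)
    then show "E (Suc k) \<le> E k" by (auto simp: E_def)
  qed
  moreover have "(\<Inter>k. E k) = {}"
  proof -
    have False if "x \<in> (\<Inter>k. E k)" for x
    proof -
      have "x \<in> E k" for k using that by blast
      then have x: "f x < 0" "\<And>k. - (1 / real (Suc k)) < f x" unfolding E_def by blast+
      obtain k where "1 / real (Suc k) < - f x"
        using x(1) nat_approx_posE[of "- f x"] by auto
      then show False using x(2)[of k] by linarith
    qed
    then show ?thesis by blast
  qed
  ultimately have "(\<lambda>k. measure M (E k)) \<longlonglongrightarrow> 0"
    using finite_Lim_measure_decseq[of E] by (simp add: image_subset_iff)
  then have "\<forall>\<^sub>F k in sequentially. measure M (E k) < \<eta> / 2"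
    by (rule order_tendstoD(2)) (use \<eta> in simp)
  then obtain k where k: "measure M (E k) < \<eta> / 2"
    by (auto simp: eventually_sequentially)
  define \<delta> where "\<delta> = 1 / real (Suc k)"
  have \<delta>: "\<delta> > 0" by (simp add: \<delta>_def)
  have Ek: "E k = {x \<in> space M. - \<delta> < f x \<and> f x < 0}" by (simp add: E_def \<delta>_def)
  \<comment> \<open>Division by \<open>\<delta>\<close> in Markov's inequality leaves
    \<open>\<eta> / 4\<close>; with the strip the total stays below \<open>\<eta>\<close>.\<close>
  have "\<forall>\<^sub>F d in sequentially. integral\<^sup>L M (p d) \<le> integral\<^sup>L M f + \<delta> * \<eta> / 4"
    using \<delta> \<eta> by (intro mean) simp
  then show "\<forall>\<^sub>F d in sequentially. measure M {x \<in> space M. f x \<le> 0 \<and> p d x > 0} < \<eta>"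
  proof eventually_elim
    fix d assume d: "integral\<^sup>L M (p d) \<le> integral\<^sup>L M f + \<delta> * \<eta> / 4"
    let ?Z = "{x \<in> space M. f x = 0}" and ?D = "{x \<in> space M. p d x - f x \<ge> \<delta>}"
    have "{x \<in> space M. f x \<le> 0 \<and> p d x > 0} \<subseteq> ?Z \<union> E k \<union> ?D"
      by (auto simp: Ek)
    then have "measure M {x \<in> space M. f x \<le> 0 \<and> p d x > 0} \<le> measure M (?Z \<union> E k \<union> ?D)"
      by (intro finite_measure_mono) auto
    also have "\<dots> \<le> measure M (?Z \<union> E k) + measure M ?D"
      by (rule measure_Un_le) measurable
    also have "measure M (?Z \<union> E k) \<le> measure M ?Z + measure M (E k)"
      by (rule measure_Un_le) measurable
    also have "measure M ?D \<le> (\<integral>x. p d x - f x \<partial>M) / \<delta>"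
      using \<delta> f p ge by (intro integral_Markov_inequality_measure[of _ _ "space M"]) auto
    also have "(\<integral>x. p d x - f x \<partial>M) / \<delta> \<le> \<eta> / 4"
      using d \<delta> f p by (simp add: field_simps)
    finally show "measure M {x \<in> space M. f x \<le> 0 \<and> p d x > 0} < \<eta>"
      using k null \<eta> by linarith
  qed
next
  fix \<eta> :: real assume "\<eta> < 0"
  then show "\<forall>\<^sub>F d in sequentially. \<eta> < measure M {x \<in> space M. f x \<le> 0 \<and> p d x > 0}"
    by (intro always_eventually allI) (meson less_le_trans measure_nonneg)
qed

section \<open>Integration over the parameter set\<close>

lemma integrable_lebesgue_on_compact:
  fixes f :: "'a::euclidean_space \<Rightarrow> real"
  assumes "compact A" "continuous_on A f"
  shows "integrable (lebesgue_on A) f"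
proof -
  obtain G where "\<And>x. x \<in> A \<Longrightarrow> \<bar>f x\<bar> \<le> G"
    using compact_continuous_bounded[OF assms] by blast
  moreover have "A \<in> sets lebesgue" using lmeasurable_compact[OF assms(1)] by (rule fmeasurableD)
  ultimately show ?thesis
    using assms lmeasurable_compact
    by (intro finite_measure.integrable_const_bound[of _ _ G] finite_measure_lebesgue_on
        continuous_imp_measurable_on_sets_lebesgue) auto
qed

text \<open>By linearity of the integral; optimality thereby becomes minimality of the mean over
  \<open>C_a\<close>.\<close>

lemma objective_eq_integral:
  fixes P :: "('m::finite, 'n::finite) problem"
  assumes A: "compact (C_a P)"
  shows "objective P s = integral\<^sup>L (lebesgue_on (C_a P)) (\<lambda>a. meval a (bound_poly s)) / measure lebesgue (C_a P)"
proof -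
  let ?N = "lebesgue_on (C_a P)"
  have meas: "C_a P \<in> sets lebesgue" using lmeasurable_compact[OF A] by (rule fmeasurableD)
  have int: "integrable ?N (\<lambda>a. \<Prod>u\<in>UNIV. a $ u ^ Poly_Mapping.lookup \<alpha> u)" for \<alpha> :: "'m \<Rightarrow>\<^sub>0 nat"
    by (intro integrable_lebesgue_on_compact A continuous_intros)
  have "moment P \<alpha> = integral\<^sup>L ?N (\<lambda>a. \<Prod>u\<in>UNIV. a $ u ^ Poly_Mapping.lookup \<alpha> u) / measure lebesgue (C_a P)" for \<alpha>
    using meas by (simp add: moment_def set_lebesgue_integral_def integral_restrict_space)
  then show ?thesis
    using int by (simp add: objective_def meval_def mhom_def sum_divide_distrib mult.commute)
qed

section \<open>Convergence of the inner approximations\<close>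

definition graph_K :: "('m::finite, 'n::finite) problem \<Rightarrow> nat \<Rightarrow> ((real ^ 'm) \<times> (real ^ 'n)) set" where
  "graph_K P i = {z. fst z \<in> C_a P \<and> snd z \<in> K P i (fst z)}"

lemma compact_graph_K:
  fixes P :: "('m::finite, 'n::finite) problem"
  assumes "compact (C_a P)" "compact (C_x P)"
  shows "compact (graph_K P i)"
proof -
  have "graph_K P i = (C_a P \<times> C_x P) \<inter> (\<Inter>g\<in>set (premise P i). {z. meval2 (fst z) (snd z) g \<le> 0})"
    by (auto simp: graph_K_def K_def)
  moreover have "closed (\<Inter>g\<in>set (premise P i). {z. meval2 (fst z) (snd z) g \<le> 0})"
    by (intro closed_INT ballI closed_Collect_le continuous_on_meval2 continuous_on_const)
  ultimately show ?thesis
    using assms by (simp add: compact_Int_closed compact_Times)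
qed

text \<open>The function \<open>J\<close> on \<open>C_a\<close> with real values, see
  \<open>J_eq_J_real\<close>; the truncation at \<open>-M\<close> keeps it finite above empty
  fibres, so that it can be integrated.\<close>

definition J_real :: "('m::finite, 'n::finite) problem \<Rightarrow> real \<Rightarrow> nat \<Rightarrow> real ^ 'm \<Rightarrow> real" where
  "J_real P M i = fibre_sup (graph_K P i) (\<lambda>z. meval2 (fst z) (snd z) (concl P i)) (- M)"

lemma upper_envelope_graph_K:
  assumes "compact (C_a P)" "compact (C_x P)"
  shows "upper_envelope (graph_K P i) (\<lambda>z. meval2 (fst z) (snd z) (concl P i))"
  using assms by unfold_locales (auto intro: compact_graph_K continuous_on_meval2)

lemma J_eq_J_real:
  fixes P :: "('m::finite, 'n::finite) problem"
  assumes "compact (C_a P)" "compact (C_x P)" and a: "a \<in> C_a P"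
  shows "J P M i a = ereal (J_real P M i a)"
proof -
  interpret upper_envelope "graph_K P i" "\<lambda>z. meval2 (fst z) (snd z) (concl P i)" "- M"
    using assms by (intro upper_envelope_graph_K)
  show ?thesis
  proof (rule antisym)
    have "J_bar P i a \<le> ereal (J_real P M i a)"
      unfolding J_bar_def J_real_def
      using fibre_sup_upper[of "(a, x)" a for x] a by (intro SUP_least) (auto simp: graph_K_def)
    then show "J P M i a \<le> ereal (J_real P M i a)"
      using fibre_sup_ge[of a] by (simp add: J_def J_real_def)
    show "ereal (J_real P M i a) \<le> J P M i a"
    proof (cases "J P M i a")
      case (real t)
      have "- M \<le> t" using real by (metis J_def ereal_less_eq(3) max.cobounded2)
      moreover have "meval2 a x (concl P i) \<le> t" if "x \<in> K P i a" for x
      proof -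
        have "ereal (meval2 a x (concl P i)) \<le> J_bar P i a"
          unfolding J_bar_def using that by (rule SUP_upper)
        also have "\<dots> \<le> ereal t" unfolding real[symmetric] J_def by simp
        finally show ?thesis by simp
      qed
      ultimately have "J_real P M i a \<le> t"
        unfolding J_real_def by (intro fibre_sup_le) (auto simp: graph_K_def)
      then show ?thesis by (simp add: real)
    next
      case MInf
      then show ?thesis by (simp add: J_def max_def split: if_splits)
    qed simp
  qed
qed

text \<open>The fibre supremum need not be continuous, so the uniform approximation is applied to a
  penalised supremum, whose mean is close by dominated convergence. The functions \<open>l\<close>
  and \<open>m\<close> stay general because \<open>empty_fibres_null\<close> uses other values than
  those defining \<open>J\<close>.\<close>

lemma polynomial_majorant:
  fixes S :: "((real ^ 'm::finite) \<times> 'b::metric_space) set"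
  assumes S: "compact S" and l: "continuous_on S l"
    and A: "compact A" and \<epsilon>: "\<epsilon> > 0"
  obtains q where "\<And>z. z \<in> S \<Longrightarrow> fst z \<in> A \<Longrightarrow> l z < meval (fst z) q" "\<And>a. a \<in> A \<Longrightarrow> m < meval a q"
    "integral\<^sup>L (lebesgue_on A) (\<lambda>a. meval a q) \<le> integral\<^sup>L (lebesgue_on A) (fibre_sup S l m) + \<epsilon>"
proof -
  let ?N = "lebesgue_on A" and ?\<mu> = "measure lebesgue A"
  let ?F = "\<lambda>n. penalty_sup S l m (real n)"
  interpret upper_envelope S l m
    using S l by unfold_locales
  interpret finite_measure ?N
    using lmeasurable_compact[OF A] by (rule finite_measure_lebesgue_on)
  have meas: "A \<in> sets lebesgue" using lmeasurable_compact[OF A] by (rule fmeasurableD)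
  have F: "integrable ?N (?F n)" for n
    by (intro integrable_lebesgue_on_compact A continuous_penalty_sup) simp
  obtain L where L: "L \<ge> m" "\<And>z. z \<in> S \<Longrightarrow> l z \<le> L" by (rule bounded_above) blast
  have bound: "\<bar>?F n a\<bar> \<le> \<bar>L\<bar> + \<bar>m\<bar>" for n a
  proof -
    have "?F n a \<le> L"
    proof (rule penalty_sup_le[OF L(1)])
      fix z assume z: "z \<in> S"
      have "0 \<le> real n * dist a (fst z)" by simp
      then show "l z - real n * dist a (fst z) \<le> L" using L(2)[OF z] by linarith
    qed
    then show ?thesis using penalty_sup_ge[of "real n" a] by simp
  qed
  have "(\<lambda>n. integral\<^sup>L ?N (?F n)) \<longlonglongrightarrow> integral\<^sup>L ?N (fibre_sup S l m)"
  proof (rule integral_dominated_convergence)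
    show "fibre_sup S l m \<in> borel_measurable ?N"
      by (rule borel_measurable_LIMSEQ_real[OF penalty_sup_tendsto]) (use F in auto)
    show "integrable ?N (\<lambda>_. \<bar>L\<bar> + \<bar>m\<bar>)" by simp
    show "AE a in ?N. (\<lambda>n. ?F n a) \<longlonglongrightarrow> fibre_sup S l m a"
      by (simp add: penalty_sup_tendsto)
  qed (use F bound in auto)
  then have "\<forall>\<^sub>F n in sequentially. integral\<^sup>L ?N (?F n) < integral\<^sup>L ?N (fibre_sup S l m) + \<epsilon> / 2"
    using \<epsilon> by (intro order_tendstoD(2)) auto
  then obtain n where n: "integral\<^sup>L ?N (?F n) < integral\<^sup>L ?N (fibre_sup S l m) + \<epsilon> / 2"
    by (auto simp: eventually_sequentially)
  \<comment> \<open>The summand 1 keeps the denominator of \<open>\<eta>\<close> positive when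
    \<open>A\<close> is a null set.\<close>
  define t where "t = ?\<mu> + 1"
  have "t > 0" by (simp add: t_def add_nonneg_pos)
  define \<eta> where "\<eta> = \<epsilon> / (4 * t)"
  have "\<eta> > 0" "\<eta> * t = \<epsilon> / 4"
    using \<epsilon> \<open>t > 0\<close> by (simp_all add: \<eta>_def)
  then have \<eta>: "\<eta> > 0" "2 * \<eta> * ?\<mu> \<le> \<epsilon> / 2"
    by (simp_all add: t_def distrib_left)
  \<comment> \<open>Approximating the function shifted by \<open>\<eta>\<close> with error below
    \<open>\<eta>\<close> puts the polynomial strictly above \<open>?F n\<close> and below
    \<open>?F n + 2 * \<eta>\<close>.\<close>
  have "continuous_on A (\<lambda>a. ?F n a + \<eta>)"
    by (intro continuous_intros continuous_penalty_sup) simp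
  then obtain q where q: "\<And>a. a \<in> A \<Longrightarrow> \<bar>?F n a + \<eta> - meval a q\<bar> < \<eta>"
    using meval_approx[OF A _ \<eta>(1)] by blast
  have lower: "?F n a < meval a q" and upper: "meval a q \<le> ?F n a + 2 * \<eta>" if "a \<in> A" for a
    using q[OF that] by linarith+
  have "integral\<^sup>L ?N (\<lambda>a. meval a q) \<le> integral\<^sup>L ?N (\<lambda>a. ?F n a + 2 * \<eta>)"
    using F upper integrable_lebesgue_on_compact[OF A continuous_on_meval]
    by (intro integral_mono) auto
  also have "\<dots> = integral\<^sup>L ?N (?F n) + 2 * \<eta> * ?\<mu>"
    using F meas by (simp add: measure_restrict_space)
  finally have int_q: "integral\<^sup>L ?N (\<lambda>a. meval a q) \<le> integral\<^sup>L ?N (fibre_sup S l m) + \<epsilon>"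
    using n \<eta>(2) by linarith
  show thesis
  proof (rule that[OF _ _ int_q])
    show "l z < meval (fst z) q" if "z \<in> S" "fst z \<in> A" for z
      using penalty_sup_upper[of "real n" z "fst z"] lower[OF that(2)] that by simp
    show "m < meval a q" if "a \<in> A" for a
      using penalty_sup_ge[of "real n" a] lower[OF that] by simp
  qed
qed

text \<open>The majorant for \<epsilon> is feasible for all large \<open>d\<close>, and an optimal
  polynomial cannot have a larger mean than a feasible one.\<close>

lemma optimal_bound_converges_in_mean:
  fixes P :: "('m::finite, 'n::finite) problem"
  assumes Cx: "compact (C_x P)" and Ca: "compact (C_a P)" and \<mu>: "measure lebesgue (C_a P) > 0"
    and ha: "archimedean_module (quadratic_module (map uminus (ha P)))"
    and hx: "archimedean_module (quadratic_module (map uminus (hx P)))"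
    and sol: "\<And>d. optimal_solution P M d i (sol d)"
    and \<epsilon>: "\<epsilon> > 0"
  shows "\<forall>\<^sub>F d in sequentially. integral\<^sup>L (lebesgue_on (C_a P)) (\<lambda>a. meval a (bound_poly (sol d)))
    \<le> integral\<^sup>L (lebesgue_on (C_a P)) (J_real P M i) + \<epsilon>"
proof -
  let ?N = "lebesgue_on (C_a P)"
  obtain q where q: "\<And>z. z \<in> graph_K P i \<Longrightarrow> fst z \<in> C_a P \<Longrightarrow>
      meval2 (fst z) (snd z) (concl P i) < meval (fst z) q" "\<And>a. a \<in> C_a P \<Longrightarrow> - M < meval a q"
    "integral\<^sup>L ?N (\<lambda>a. meval a q) \<le> integral\<^sup>L ?N (J_real P M i) + \<epsilon>"
    unfolding J_real_def
    by (rule polynomial_majorant[OF compact_graph_K[OF Ca Cx] continuous_on_meval2 Ca \<epsilon>]) blast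
  have "meval2 a x (concl P i) < meval a q" if "a \<in> C_a P" "x \<in> K P i a" for a x
    using q(1)[of "(a, x)"] that by (simp add: graph_K_def)
  then obtain s where s: "bound_poly s = q" "\<forall>\<^sub>F d in sequentially. feasible P M d i s"
    using feasible_strict_upper_bound[OF ha hx _ q(2)] by blast
  from s(2) show ?thesis
  proof eventually_elim
    fix d assume "feasible P M d i s"
    then have "objective P (sol d) \<le> objective P s"
      using sol by (auto simp: optimal_solution_def)
    then show "integral\<^sup>L ?N (\<lambda>a. meval a (bound_poly (sol d))) \<le> integral\<^sup>L ?N (J_real P M i) + \<epsilon>"
      using q(3) \<mu> by (simp add: objective_eq_integral[OF Ca] divide_le_cancel s(1))
  qed
qed

text \<open>
  Over parameters with \<open>K P i a = {}\<close> the identities of the program do not bound \<open>p\<close> from below,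
  but if such parameters had positive measure, a polynomial that is positive on the graph of \<open>K\<close>
  and has negative mean could be added to any feasible point, contradicting solvability.
\<close>

lemma empty_fibres_null:
  fixes P :: "('m::finite, 'n::finite) problem"
  assumes Cx: "compact (C_x P)" and Ca: "compact (C_a P)" and \<mu>: "measure lebesgue (C_a P) > 0"
    and ha: "archimedean_module (quadratic_module (map uminus (ha P)))"
    and hx: "archimedean_module (quadratic_module (map uminus (hx P)))"
    and sol: "\<And>d. optimal_solution P M d i (sol d)"
  shows "AE a in lebesgue_on (C_a P). K P i a \<noteq> {}"
proof (rule ccontr)
  assume not_AE: "\<not> (AE a in lebesgue_on (C_a P). K P i a \<noteq> {})"
  let ?N = "lebesgue_on (C_a P)" and ?S = "graph_K P i" and ?E = "{a \<in> C_a P. K P i a = {}}"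
  have S: "compact ?S" using Ca Cx by (rule compact_graph_K)
  interpret finite_measure ?N
    using lmeasurable_compact[OF Ca] by (rule finite_measure_lebesgue_on)
  \<comment> \<open>The exceptional set is measurable as the complement in \<open>C_a P\<close> of
    the projection of a compact set.\<close>
  have "fst ` ?S = {a \<in> C_a P. K P i a \<noteq> {}}"
    by (auto simp: graph_K_def image_iff Bex_def)
  then have "?E = C_a P - fst ` ?S" by auto
  moreover have "C_a P \<in> sets lebesgue" "fst ` ?S \<in> sets lebesgue"
    using S Ca by (auto intro!: fmeasurableD lmeasurable_compact compact_continuous_image continuous_intros)
  ultimately have E: "?E \<in> sets ?N"
    by (auto simp: sets_restrict_space_iff)
  have "measure ?N ?E \<noteq> 0"
  proof
    assume "measure ?N ?E = 0"
    then have "?E \<in> null_sets ?N" using E by (auto simp: emeasure_eq_measure)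
    then have "AE a in ?N. a \<notin> ?E" by (rule AE_not_in)
    then have "AE a in ?N. K P i a \<noteq> {}"
      by (rule AE_mp) (auto intro!: AE_I2)
    then show False using not_AE by blast
  qed
  then have E_pos: "measure ?N ?E > 0" by (simp add: zero_less_measure_iff)
  \<comment> \<open>For \<open>l = 0\<close> and \<open>m = -1\<close> the fibre supremum is 0 above
    nonempty fibres and -1 above empty ones. Its mean is minus the measure of \<open>?E\<close>, and
    a slack of half that measure leaves a negative integral.\<close>
  obtain q where q: "\<And>z. z \<in> ?S \<Longrightarrow> fst z \<in> C_a P \<Longrightarrow> 0 < meval (fst z) q"
    "integral\<^sup>L ?N (\<lambda>a. meval a q) \<le> integral\<^sup>L ?N (fibre_sup ?S (\<lambda>_. 0) (- 1)) + measure ?N ?E / 2"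
    by (rule polynomial_majorant[OF S continuous_on_const[of _ "0::real"] Ca half_gt_zero[OF E_pos],
          where m = "- 1"]) blast
  have "integral\<^sup>L ?N (fibre_sup ?S (\<lambda>_. 0) (- 1)) = integral\<^sup>L ?N (\<lambda>a. - indicator ?E a)"
  proof (rule Bochner_Integration.integral_cong[OF refl])
    fix a assume a: "a \<in> space ?N"
    show "fibre_sup ?S (\<lambda>_. 0) (- 1) a = - indicator ?E a"
    proof (cases "K P i a = {}")
      case True
      then have fibre: "{z \<in> ?S. fst z = a} = {}" by (auto simp: graph_K_def)
      show ?thesis unfolding fibre_sup_def fibre using True a by simp
    next
      case False
      then obtain x where "x \<in> K P i a" by blast
      then have "(a, x) \<in> {z \<in> ?S. fst z = a}" using a by (simp add: graph_K_def)
      then have fibre: "insert (- 1) ((\<lambda>_. 0) ` {z \<in> ?S. fst z = a}) = {- 1, 0 :: real}" by blast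
      show ?thesis unfolding fibre_sup_def fibre using False by (simp add: cSup_eq_Max)
    qed
  qed
  also have "\<dots> = - measure ?N ?E"
  proof -
    have "?E \<inter> C_a P = ?E" by blast
    then show ?thesis by simp
  qed
  finally have neg: "integral\<^sup>L ?N (\<lambda>a. meval a q) < 0" using q(2) E_pos by linarith
  have "emb_a q \<in> quadratic_module (joint_generators P i)"
  proof (rule positive_in_joint_module[OF ha hx])
    show "0 < meval2 a x (emb_a q)" if "a \<in> C_a P" "x \<in> K P i a" for a x
      using q(1)[of "(a, x)"] that by (simp add: graph_K_def)
  qed
  then obtain r where r: "emb_a q = representation P i r" "\<forall>\<^sub>F d in sequentially. valid_multipliers P d i r"
    by (rule joint_module_representation)
  from r(2) eventually_deg_le[of q]
  have "\<forall>\<^sub>F d in sequentially. valid_multipliers P d i r \<and> deg_le (2 * d) q"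
    by (rule eventually_conj)
  then obtain d where d: "valid_multipliers P d i r" "deg_le (2 * d) q"
    by (auto simp: eventually_sequentially)
  have opt: "feasible P M d i (sol d)" "\<And>s'. feasible P M d i s' \<Longrightarrow> objective P (sol d) \<le> objective P s'"
    using sol[of d] by (auto simp: optimal_solution_def)
  obtain s' where s': "feasible P M d i s'" "bound_poly s' = bound_poly (sol d) + q"
    using feasible_add[OF opt(1) d(2,1) r(1)] by blast
  have int: "integrable ?N (\<lambda>a. meval a p)" for p
    by (intro integrable_lebesgue_on_compact Ca continuous_on_meval)
  have "integral\<^sup>L ?N (\<lambda>a. meval a (bound_poly (sol d))) \<le> integral\<^sup>L ?N (\<lambda>a. meval a (bound_poly (sol d) + q))"
    using opt(2)[OF s'(1)] \<mu> by (simp add: objective_eq_integral[OF Ca] divide_le_cancel s'(2))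
  then show False using neg int by (simp add: meval.add)
qed

text \<open>Each identity is evaluated at a point of the fibre, where its right-hand side is
  nonnegative. The bound by \<open>-M\<close> needs such a point too, as the second identity
  contains the premise polynomials.\<close>

lemma J_real_le_feasible:
  fixes P :: "('m::finite, 'n::finite) problem"
  assumes Cx: "compact (C_x P)" and Ca: "compact (C_a P)"
    and feas: "feasible P M d i s" and a: "a \<in> C_a P" and ne: "K P i a \<noteq> {}"
  shows "J_real P M i a \<le> meval a (bound_poly s)"
proof -
  interpret upper_envelope "graph_K P i" "\<lambda>z. meval2 (fst z) (snd z) (concl P i)" "- M"
    using Ca Cx by (intro upper_envelope_graph_K)
  have nonneg: "0 \<le> meval2 a x (emb_a (bound_poly s) - concl P i)"
    "0 \<le> meval2 a x (emb_a (bound_poly s) + mconst M)" if "x \<in> K P i a" for x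
    using feas representation_nonneg[OF _ a that] by (auto simp: feasible_def)
  have sub: "meval2 a x (p - r) = meval2 a x p - meval2 a x r"
    "meval2 a x (p + mconst M) = meval2 a x p + M" for x :: "real ^ 'n" and p r :: "('m + 'n) mpoly"
    by (simp_all add: meval2_eq meval.diff meval.add)
  show ?thesis
    unfolding J_real_def
  proof (rule fibre_sup_le)
    obtain x where "x \<in> K P i a" using ne by blast
    then show "- M \<le> meval a (bound_poly s)" using nonneg(2)[of x] by (simp add: sub)
    fix z assume "z \<in> graph_K P i" "fst z = a"
    then have "snd z \<in> K P i a" by (auto simp: graph_K_def)
    then show "meval2 (fst z) (snd z) (concl P i) \<le> meval a (bound_poly s)"
      using nonneg(1)[of "snd z"] \<open>fst z = a\<close> by (simp add: sub)
  qed
qed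

theorem theorem3:
  fixes P :: "('m::finite, 'n::finite) problem"
    and M :: real
    and sol :: "nat \<Rightarrow> nat \<Rightarrow> ('m, 'n) sos_point"
  assumes "guards_disjoint P"
    and "states_stay P"
    and "compact (C_x P)"
    and "compact (C_a P)"
    and "measure lebesgue (C_a P) > 0"
    and "M > 0"
    and "\<And>i a. i \<le> num_branches P + 1 \<Longrightarrow> a \<in> C_a P \<Longrightarrow>
           archimedean_module (quadratic_module
             (map uminus (map (specialize a) (premise P i) @ hx P)))"
    and "archimedean_module (quadratic_module (map uminus (ha P)))"
    and "archimedean_module (quadratic_module (map uminus (hx P)))"
    and "\<And>d i. i \<le> num_branches P + 1 \<Longrightarrow> optimal_solution P M d i (sol d i)"
    and "\<And>i. i \<le> num_branches P + 1 \<Longrightarrow> R_I_r P M i \<in> null_sets lebesgue"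
  shows "\<forall>i \<le> num_branches P + 1.
           (\<lambda>d. measure lebesgue (R_I P i - R_approx P (sol d i))) \<longlonglongrightarrow> 0"
proof (intro allI impI)
  fix i assume i: "i \<le> num_branches P + 1"
  note Cx = assms(3) and Ca = assms(4) and \<mu> = assms(5) and ha = assms(8) and hx = assms(9)
  note sol = assms(10)[OF i]
  let ?N = "lebesgue_on (C_a P)" and ?p = "\<lambda>d a. meval a (bound_poly (sol d i))"
  interpret upper_envelope "graph_K P i" "\<lambda>z. meval2 (fst z) (snd z) (concl P i)" "- M"
    using Ca Cx by (intro upper_envelope_graph_K)
  interpret finite_measure ?N
    using lmeasurable_compact[OF Ca] by (rule finite_measure_lebesgue_on)
  have meas: "C_a P \<in> sets lebesgue" using lmeasurable_compact[OF Ca] by (rule fmeasurableD)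
  have int_p: "integrable ?N (?p d)" for d
    by (intro integrable_lebesgue_on_compact Ca continuous_on_meval)
  have int_J: "integrable ?N (J_real P M i)"
  proof -
    obtain L where L: "L \<ge> - M" "\<And>z. z \<in> graph_K P i \<Longrightarrow> meval2 (fst z) (snd z) (concl P i) \<le> L"
      by (rule bounded_above) blast
    have "- M \<le> J_real P M i a" "J_real P M i a \<le> L" for a
      unfolding J_real_def using L by (auto intro: fibre_sup_ge fibre_sup_le)
    then have "\<bar>J_real P M i a\<bar> \<le> \<bar>L\<bar> + \<bar>M\<bar>" for a
      by (smt (verit))
    \<comment> \<open>Measurable as a pointwise limit of the continuous penalised suprema.\<close>
    moreover have "J_real P M i \<in> borel_measurable ?N"
      unfolding J_real_def
      by (rule borel_measurable_LIMSEQ_real[OF penalty_sup_tendsto])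
        (intro borel_measurable_integrable integrable_lebesgue_on_compact Ca continuous_penalty_sup, simp)
    ultimately show ?thesis
      by (intro integrable_const_bound[of _ "\<bar>L\<bar> + \<bar>M\<bar>"]) auto
  qed
  have AE_ge: "AE a in ?N. J_real P M i a \<le> ?p d a" for d
    using empty_fibres_null[OF Cx Ca \<mu> ha hx sol]
  proof (rule AE_mp, intro AE_I2 impI)
    fix a assume "a \<in> space ?N" "K P i a \<noteq> {}"
    then show "J_real P M i a \<le> ?p d a"
      using sol[of d] by (intro J_real_le_feasible[OF Cx Ca]) (auto simp: optimal_solution_def)
  qed
  have "{a \<in> space ?N. J_real P M i a = 0} = R_I_r P M i"
    using J_eq_J_real[OF Ca Cx, of _ M i] by (auto simp: R_I_r_def zero_ereal_def)
  then have null: "measure ?N {a \<in> space ?N. J_real P M i a = 0} = 0"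
    using measure_eq_0_null_sets[OF assms(11)[OF i]] meas
    by (subst measure_restrict_space) auto
  have lim: "(\<lambda>d. measure ?N {a \<in> space ?N. J_real P M i a \<le> 0 \<and> ?p d a > 0}) \<longlonglongrightarrow> 0"
    by (rule sublevel_difference_tendsto[OF int_J int_p AE_ge _ null])
      (rule optimal_bound_converges_in_mean[OF Cx Ca \<mu> ha hx sol])
  \<comment> \<open>The case split replaces a measurability proof for \<open>R_I\<close>: a set that
    is not measurable has measure 0 by convention, and the bound is then trivial.\<close>
  have le: "measure lebesgue (R_I P i - R_approx P (sol d i))
      \<le> measure ?N {a \<in> space ?N. J_real P M i a \<le> 0 \<and> ?p d a > 0}" for d
  proof (cases "R_I P i - R_approx P (sol d i) \<in> sets lebesgue")
    case True
    have sub: "R_I P i - R_approx P (sol d i) \<subseteq> {a \<in> space ?N. J_real P M i a \<le> 0 \<and> ?p d a > 0}"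
    proof
      fix a assume a: "a \<in> R_I P i - R_approx P (sol d i)"
      then have K: "a \<in> C_a P" "\<forall>x\<in>K P i a. meval2 a x (concl P i) \<le> 0"
        using R_I_subset[OF i] by auto
      \<comment> \<open>Positivity of \<open>M\<close> makes the inserted value \<open>-M\<close>
        nonpositive, which settles empty fibres as well.\<close>
      then have "J_real P M i a \<le> 0"
        unfolding J_real_def using assms(6) by (intro fibre_sup_le) (auto simp: graph_K_def)
      then show "a \<in> {a \<in> space ?N. J_real P M i a \<le> 0 \<and> ?p d a > 0}"
        using a K(1) by (auto simp: R_approx_def)
    qed
    have [measurable]: "J_real P M i \<in> borel_measurable ?N" "?p d \<in> borel_measurable ?N"
      using int_J int_p by auto
    have subC: "R_I P i - R_approx P (sol d i) \<subseteq> C_a P" using sub by auto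
    then have "measure lebesgue (R_I P i - R_approx P (sol d i)) = measure ?N (R_I P i - R_approx P (sol d i))"
      using meas by (simp add: measure_restrict_space)
    also have "\<dots> \<le> measure ?N {a \<in> space ?N. J_real P M i a \<le> 0 \<and> ?p d a > 0}"
      using sub by (intro finite_measure_mono) measurable
    finally show ?thesis .
  qed (simp add: measure_notin_sets)
  show "(\<lambda>d. measure lebesgue (R_I P i - R_approx P (sol d i))) \<longlonglongrightarrow> 0"
  proof (rule tendsto_sandwich[OF _ _ tendsto_const lim])
    show "\<forall>\<^sub>F d in sequentially. measure lebesgue (R_I P i - R_approx P (sol d i))
        \<le> measure ?N {a \<in> space ?N. J_real P M i a \<le> 0 \<and> ?p d a > 0}"
      by (intro always_eventually allI le)
  qed simp
qed

end
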